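(* Suppose $\mathcal K$ is a transitive projective Fraïssé class such that the image of ${\rm Aut}(\mathbb K)$ under the canonical homomorphism ${\rm pr}$ is dense in ${\rm Homeo}(K)$, and let $n\in\mathbb N$. (i) If there exists $\bar\gamma\in{\rm Homeo}(K)^n$ such that $\bar\gamma^{{\rm Homeo}(K)}$ is dense in ${\rm Homeo}(K)^n$, then $\mathcal K^{\times n}_{\rm p}$ has the approximate JPP. (ii) If the set of all $\bar\gamma\in{\rm Aut}(\mathbb K)^n$ such that $\bar\gamma^{{\rm Homeo}(K)}$ is dense in ${\rm Homeo}(K)^n$ is comeager in ${\rm Aut}(\mathbb K)^n$, then $\mathcal K^{\times n}_{\rm p}$ has the half-approximate JPP. (iii) If there exists $\bar\gamma\in{\rm Aut}(\mathbb K)^n$ such that $\bar\gamma^{{\rm Aut}(\mathbb K)}$ is dense in ${\rm Aut}(\mathbb K)^n$, then $\mathcal K^{\times n}_{\rm p}$ has the JPP.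
   Context: Reflexive graph: set with reflexive symmetric relation $R$; strong homomorphism: $R$-preserving map such that every $R$-related pair in the target is the image of an $R$-related pair. $\mathcal K$: countable category of finite reflexive graphs with morphism sets ${\rm Epi}(A,B)$ of strong homomorphisms, satisfying (o) [if $f\in{\rm Epi}(A,B)$, $h\in{\rm Epi}(A,C)$, $g:B\to C$, $h=g\circ f$, then $g\in{\rm Epi}(B,C)$], joint projection, projective amalgamation. $\mathbb K=\varprojlim(A_n,\pi_n)$ for a generic sequence ($A_n\in\mathcal K$, $\pi_n\in{\rm Epi}(A_{n+1},A_n)$, every $A\in\mathcal K$ receives a morphism from some $A_m$, every $f\in{\rm Epi}(A,A_m)$ satisfies $f\circ g=\pi_m\circ\cdots\circ\pi_{n-1}$ for some $n>m$, $g\in{\rm Epi}(A_n,A)$), ${\rm Epi}(\mathbb K,A)=\{f\circ\pi^\infty_n:f\in{\rm Epi}(A_n,A)\}$. $xR^{\mathbb K}y$ iff $\varphi(x)R\varphi(y)$ for all such $\varphi$; transitive means $R^{\mathbb K}$ transitive; $K=\mathbb K/R^{\mathbb K}$ with quotient map ${\rm pr}$. ${\rm Aut}(\mathbb K)$: homeomorphisms $\sigma$ of $\mathbb K$ with $\varphi\circ\sigma,\varphi\circ\sigma^{-1}\in{\rm Epi}(\mathbb K,A)$ for all $\varphi\in{\rm Epi}(\mathbb K,A)$, topologized by uniform convergence on $\mathbb K$; ${\rm pr}(\sigma)({\rm pr}(x))={\rm pr}(\sigma(x))$ gives a continuous homomorphism into ${\rm Homeo}(K)$ (uniform convergence topology);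 elements of ${\rm Aut}(\mathbb K)$ are regarded as elements of ${\rm Homeo}(K)$ via ${\rm pr}$. For a group $G$ and $\bar\gamma=(\gamma_j)_{j<n}$, $\bar\gamma^{G}=\{(g\gamma_jg^{-1})_{j<n}:g\in G\}$. $\mathcal K^{\times n}_{\rm p}$: objects $(A,B,\bar f,\bar g)$ with $A,B\in\mathcal K$, $f_i,g_i\in{\rm Epi}(A,B)$ ($i<n$); $\alpha\in{\rm Epi}(A,A')$ is an epimorphism (resp. approximate epimorphism) from $(A,B,\bar f,\bar g)$ to $(A',B',\bar f',\bar g')$ if for all $i<n$ and $a_0,a_1\in A$ with $f_i(a_0)=g_i(a_1)$ we have $f'_i(\alpha(a_0))=g'_i(\alpha(a_1))$ (resp. $f'_i(\alpha(a_0))Rg'_i(\alpha(a_1))$). $\mathcal K^{\times n}_{\rm p}$ has the JPP (resp. half-approximate JPP, approximate JPP) if for any two objects $X,X'$ there are an object $X^+$ and $\alpha:X^+\to X$, $\alpha':X^+\to X'$ with both epimorphisms (resp. $\alpha$ an epimorphism and $\alpha'$ an approximate epimorphism; resp. both approximate epimorphisms). *)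

theory Defs
  imports "HOL-Analysis.Analysis" "HOL-Algebra.Bij"
begin

definition dense_in :: "'a topology \<Rightarrow> 'a set \<Rightarrow> bool" where
  "dense_in X S \<longleftrightarrow> S \<subseteq> topspace X \<and> X closure_of S = topspace X"

definition comeager_in :: "'a topology \<Rightarrow> 'a set \<Rightarrow> bool" where
  "comeager_in X S \<longleftrightarrow> S \<subseteq> topspace X \<and>
     (\<exists>\<U>. countable \<U> \<and> (\<forall>U\<in>\<U>. openin X U \<and> dense_in X U) \<and> topspace X \<inter> \<Inter>\<U> \<subseteq> S)"

text \<open>Homeomorphisms are extensional functions on the underlying set, so that equal maps are equal
  elements of the group. Below, only the carrier of the group of all bijections is changed.\<close>

definition Homeo :: "'a topology \<Rightarrow> ('a \<Rightarrow> 'a) set" where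
  "Homeo X = {f \<in> extensional (topspace X). homeomorphic_map X X f}"

definition homeo_group :: "'a topology \<Rightarrow> ('a \<Rightarrow> 'a) monoid" where
  "homeo_group X = (BijGroup (topspace X)) \<lparr>carrier := Homeo X\<rparr>"

text \<open>The topology of uniform convergence on the homeomorphisms of \<open>X\<close>. It is meant for compact
  Hausdorff \<open>X\<close>, whose unique compatible uniformity consists of all neighbourhoods of the
  diagonal. For compact \<open>X\<close> with any compatible metric, it is the topology of the supremum
  metric: see \<open>openin_uniform_topology_metric\<close> below.\<close>

definition entourage :: "'a topology \<Rightarrow> ('a \<times> 'a) set \<Rightarrow> bool" where
  "entourage X E \<longleftrightarrow> openin (prod_topology X X) E \<and> (\<forall>x\<in>topspace X. (x, x) \<in> E)"

definition uniform_topology :: "'a topology \<Rightarrow> ('a \<Rightarrow> 'a) topology" where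
  "uniform_topology X = topology (\<lambda>W. W \<subseteq> Homeo X \<and>
     (\<forall>f\<in>W. \<exists>E. entourage X E \<and> {g \<in> Homeo X. \<forall>x\<in>topspace X. (f x, g x) \<in> E} \<subseteq> W))"

lemma openin_uniform_topology:
  "openin (uniform_topology X) W \<longleftrightarrow> W \<subseteq> Homeo X \<and>
     (\<forall>f\<in>W. \<exists>E. entourage X E \<and> {g \<in> Homeo X. \<forall>x\<in>topspace X. (f x, g x) \<in> E} \<subseteq> W)"
proof -
  have "istopology (\<lambda>W. W \<subseteq> Homeo X \<and>
     (\<forall>f\<in>W. \<exists>E. entourage X E \<and> {g \<in> Homeo X. \<forall>x\<in>topspace X. (f x, g x) \<in> E} \<subseteq> W))"
    (is "istopology ?P")
    unfolding istopology_def
  proof (intro conjI allI impI)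
    fix S T assume S: "?P S" and T: "?P T"
    show "S \<inter> T \<subseteq> Homeo X" using S by blast
    show "\<forall>f\<in>S \<inter> T. \<exists>E. entourage X E \<and>
        {g \<in> Homeo X. \<forall>x\<in>topspace X. (f x, g x) \<in> E} \<subseteq> S \<inter> T"
    proof
      fix f assume f: "f \<in> S \<inter> T"
      obtain E where E: "entourage X E" "{g \<in> Homeo X. \<forall>x\<in>topspace X. (f x, g x) \<in> E} \<subseteq> S"
        using S f by blast
      obtain F where F: "entourage X F" "{g \<in> Homeo X. \<forall>x\<in>topspace X. (f x, g x) \<in> F} \<subseteq> T"
        using T f by blast
      have "entourage X (E \<inter> F)" using E(1) F(1) by (auto simp: entourage_def)
      moreover have "{g \<in> Homeo X. \<forall>x\<in>topspace X. (f x, g x) \<in> E \<inter> F} \<subseteq> S \<inter> T"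
        using E(2) F(2) by blast
      ultimately show "\<exists>E. entourage X E \<and>
          {g \<in> Homeo X. \<forall>x\<in>topspace X. (f x, g x) \<in> E} \<subseteq> S \<inter> T" by blast
    qed
  next
    fix \<K> assume a: "\<forall>K\<in>\<K>. ?P K"
    then show "\<Union>\<K> \<subseteq> Homeo X" by blast
    show "\<forall>f\<in>\<Union>\<K>. \<exists>E. entourage X E \<and>
        {g \<in> Homeo X. \<forall>x\<in>topspace X. (f x, g x) \<in> E} \<subseteq> \<Union>\<K>"
      using a by (meson Union_iff Union_upper subset_trans)
  qed
  then show ?thesis by (simp add: uniform_topology_def topology_inverse')
qed

lemma topspace_uniform_topology [simp]: "topspace (uniform_topology X) = Homeo X"
proof -
  have "openin (uniform_topology X) (Homeo X)"
    unfolding openin_uniform_topology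
    by (auto simp: entourage_def intro!: exI [of _ "topspace (prod_topology X X)"])
  then show ?thesis
    by (metis openin_subset openin_topspace openin_uniform_topology subset_antisym)
qed

lemma (in Metric_space) openin_uniform_topology_metric:
  assumes "compact_space mtopology"
  shows "openin (uniform_topology mtopology) W \<longleftrightarrow> W \<subseteq> Homeo mtopology \<and>
    (\<forall>f\<in>W. \<exists>e>0. {g \<in> Homeo mtopology. \<forall>x\<in>M. d (f x) (g x) < e} \<subseteq> W)"
proof -
  have in_M: "f x \<in> M" if "f \<in> Homeo mtopology" "x \<in> M" for f x
    using that homeomorphic_imp_surjective_map [of mtopology mtopology f]
    by (auto simp: Homeo_def)
  have small: "\<exists>e>0. \<forall>x\<in>M. \<forall>y\<in>M. d x y < e \<longrightarrow> (x, y) \<in> E" if E: "entourage mtopology E" for E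
  proof -
    have "\<exists>U. openin mtopology U \<and> x \<in> U \<and> U \<times> U \<subseteq> E" if x: "x \<in> M" for x
    proof -
      have xx: "(x, x) \<in> E" using E x by (auto simp: entourage_def)
      have "openin (prod_topology mtopology mtopology) E" using E by (auto simp: entourage_def)
      then obtain U V where "openin mtopology U" "openin mtopology V" "x \<in> U" "x \<in> V" "U \<times> V \<subseteq> E"
        using xx unfolding openin_prod_topology_alt by meson
      then show ?thesis
        by (intro exI [of _ "U \<inter> V"]) auto
    qed
    then obtain U where U: "\<And>x. x \<in> M \<Longrightarrow> openin mtopology (U x) \<and> x \<in> U x \<and> U x \<times> U x \<subseteq> E"
      by metis
    have "compactin mtopology M" using assms by (simp add: compact_space_def)
    moreover have "M \<subseteq> \<Union>(U ` M)" using U by blast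
    moreover have "\<And>V. V \<in> U ` M \<Longrightarrow> openin mtopology V" using U by blast
    ultimately obtain e where "e > 0" and e: "\<And>x. x \<in> M \<Longrightarrow> \<exists>V\<in>U ` M. mball x e \<subseteq> V"
      using lebesgue_number [of M "U ` M"] by (metis subset_iff)
    have "(x, y) \<in> E" if "x \<in> M" "y \<in> M" "d x y < e" for x y
    proof -
      obtain z where z: "z \<in> M" "mball x e \<subseteq> U z" using e [OF \<open>x \<in> M\<close>] by blast
      then show ?thesis using U [of z] that \<open>e > 0\<close> by fastforce
    qed
    then show ?thesis using \<open>e > 0\<close> by blast
  qed
  have ball: "entourage mtopology {(x, y). x \<in> M \<and> y \<in> M \<and> d x y < e}" if "e > 0" for e
  proof -
    have "\<exists>U V. openin mtopology U \<and> openin mtopology V \<and> x \<in> U \<and> y \<in> V \<and>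
        U \<times> V \<subseteq> {(x, y). x \<in> M \<and> y \<in> M \<and> d x y < e}"
      if xy: "x \<in> M" "y \<in> M" "d x y < e" for x y
    proof -
      define r where "r = (e - d x y) / 2"
      have r: "r > 0" "2 * r = e - d x y" using xy by (auto simp: r_def)
      have "d a b < e" if "a \<in> mball x r" "b \<in> mball y r" for a b
      proof -
        have "a \<in> M" "b \<in> M" "d x a < r" "d y b < r" using that by auto
        moreover have "d a b \<le> d a x + d x b" "d x b \<le> d x y + d y b"
          using triangle \<open>a \<in> M\<close> \<open>b \<in> M\<close> xy by auto
        moreover have "d a x = d x a" by (rule commute)
        ultimately show ?thesis using r(2) by linarith
      qed
      then have "mball x r \<times> mball y r \<subseteq> {(x, y). x \<in> M \<and> y \<in> M \<and> d x y < e}" by auto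
      then show ?thesis using r(1) xy
        by (intro exI [of _ "mball x r"] exI [of _ "mball y r"]) auto
    qed
    then have "openin (prod_topology mtopology mtopology) {(x, y). x \<in> M \<and> y \<in> M \<and> d x y < e}"
      by (subst openin_prod_topology_alt) auto
    then show ?thesis using that by (auto simp: entourage_def)
  qed
  have "(\<exists>E. entourage mtopology E \<and> {g \<in> Homeo mtopology. \<forall>x\<in>M. (f x, g x) \<in> E} \<subseteq> W) \<longleftrightarrow>
      (\<exists>e>0. {g \<in> Homeo mtopology. \<forall>x\<in>M. d (f x) (g x) < e} \<subseteq> W)" (is "?L \<longleftrightarrow> ?R")
    if f: "f \<in> Homeo mtopology" for f
  proof
    assume ?L
    then obtain E where E: "entourage mtopology E"
      "{g \<in> Homeo mtopology. \<forall>x\<in>M. (f x, g x) \<in> E} \<subseteq> W" by blast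
    obtain e where e: "e > 0" "\<forall>x\<in>M. \<forall>y\<in>M. d x y < e \<longrightarrow> (x, y) \<in> E" using small E(1) by blast
    have "{g \<in> Homeo mtopology. \<forall>x\<in>M. d (f x) (g x) < e} \<subseteq>
        {g \<in> Homeo mtopology. \<forall>x\<in>M. (f x, g x) \<in> E}"
      using e(2) in_M f by blast
    then show ?R using e(1) E(2) by blast
  next
    assume ?R
    then obtain e where e: "e > 0" "{g \<in> Homeo mtopology. \<forall>x\<in>M. d (f x) (g x) < e} \<subseteq> W" by blast
    have "{g \<in> Homeo mtopology. \<forall>x\<in>M. (f x, g x) \<in> {(x, y). x \<in> M \<and> y \<in> M \<and> d x y < e}} \<subseteq>
        {g \<in> Homeo mtopology. \<forall>x\<in>M. d (f x) (g x) < e}"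
      by blast
    then show ?L using ball [OF e(1)] e(2) by (meson subset_trans)
  qed
  then show ?thesis
    unfolding openin_uniform_topology topspace_mtopology by (meson subset_iff)
qed

definition quotient_topology :: "'a topology \<Rightarrow> 'a rel \<Rightarrow> 'a set topology" where
  "quotient_topology X R = topology (\<lambda>U. U \<subseteq> topspace X // R \<and>
     openin X {x \<in> topspace X. R `` {x} \<in> U})"

lemma openin_quotient_topology:
  "openin (quotient_topology X R) U \<longleftrightarrow> U \<subseteq> topspace X // R \<and>
     openin X {x \<in> topspace X. R `` {x} \<in> U}"
proof -
  have "istopology (\<lambda>U. U \<subseteq> topspace X // R \<and> openin X {x \<in> topspace X. R `` {x} \<in> U})"
    (is "istopology ?P")
    unfolding istopology_def
  proof (intro conjI allI impI)
    fix S T assume S: "?P S" and T: "?P T"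
    show "S \<inter> T \<subseteq> topspace X // R" using S by blast
    have "{x \<in> topspace X. R `` {x} \<in> S \<inter> T} =
        {x \<in> topspace X. R `` {x} \<in> S} \<inter> {x \<in> topspace X. R `` {x} \<in> T}" by blast
    then show "openin X {x \<in> topspace X. R `` {x} \<in> S \<inter> T}" using S T by (simp add: openin_Int)
  next
    fix \<K> assume a: "\<forall>K\<in>\<K>. ?P K"
    then show "\<Union>\<K> \<subseteq> topspace X // R" by blast
    have "{x \<in> topspace X. R `` {x} \<in> \<Union>\<K>} = (\<Union>K\<in>\<K>. {x \<in> topspace X. R `` {x} \<in> K})" by blast
    then show "openin X {x \<in> topspace X. R `` {x} \<in> \<Union>\<K>}" using a by auto
  qed
  then show ?thesis by (simp add: quotient_topology_def topology_inverse')
qed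

lemma topspace_quotient_topology [simp]: "topspace (quotient_topology X R) = topspace X // R"
proof -
  have "{x \<in> topspace X. R `` {x} \<in> topspace X // R} = topspace X" by (auto simp: quotientI)
  then have "openin (quotient_topology X R) (topspace X // R)"
    by (simp add: openin_quotient_topology)
  then show ?thesis
    by (metis openin_subset openin_topspace openin_quotient_topology subset_antisym)
qed

text \<open>An \<open>n\<close>-tuple in \<open>S\<close> is an element of \<open>{..<n} \<rightarrow>\<^sub>E S\<close>.\<close>

definition conj_class :: "('a, 'b) monoid_scheme \<Rightarrow> nat \<Rightarrow> (nat \<Rightarrow> 'a) \<Rightarrow> (nat \<Rightarrow> 'a) set" where
  "conj_class G n \<gamma> =
     {(\<lambda>j\<in>{..<n}. g \<otimes>\<^bsub>G\<^esub> \<gamma> j \<otimes>\<^bsub>G\<^esub> inv\<^bsub>G\<^esub> g) | g. g \<in> carrier G}"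

definition power_topology :: "'a topology \<Rightarrow> nat \<Rightarrow> (nat \<Rightarrow> 'a) topology" where
  "power_topology X n = product_topology (\<lambda>_. X) {..<n}"

record 'v rgraph =
  verts :: "'v set"
  adj :: "'v rel"

definition finite_reflexive_graph :: "'v rgraph \<Rightarrow> bool" where
  "finite_reflexive_graph A \<longleftrightarrow> finite (verts A) \<and> adj A \<subseteq> verts A \<times> verts A \<and>
     refl_on (verts A) (adj A) \<and> sym (adj A)"

definition strong_hom :: "'v rgraph \<Rightarrow> 'v rgraph \<Rightarrow> ('v \<Rightarrow> 'v) set" where
  "strong_hom A B = {f \<in> verts A \<rightarrow>\<^sub>E verts B.
     (\<forall>(x, y) \<in> adj A. (f x, f y) \<in> adj B) \<and>
     (\<forall>(u, v) \<in> adj B. \<exists>(x, y) \<in> adj A. f x = u \<and> f y = v)}"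

text \<open>\<open>Epi\<close> is only constrained on the objects \<open>\<K>\<close>. In \<open>right_factor\<close>, \<open>g\<close> is an arbitrary function
  between the vertex sets, not assumed to be a homomorphism.\<close>

locale projective_fraisse_class =
  fixes \<K> :: "'v rgraph set"
    and Epi :: "'v rgraph \<Rightarrow> 'v rgraph \<Rightarrow> ('v \<Rightarrow> 'v) set"
  assumes countable_objects: "countable \<K>"
    and graphs: "A \<in> \<K> \<Longrightarrow> finite_reflexive_graph A"
    and Epi_strong: "\<lbrakk>A \<in> \<K>; B \<in> \<K>\<rbrakk> \<Longrightarrow> Epi A B \<subseteq> strong_hom A B"
    and Epi_id: "A \<in> \<K> \<Longrightarrow> (\<lambda>x\<in>verts A. x) \<in> Epi A A"
    and Epi_comp: "\<lbrakk>A \<in> \<K>; B \<in> \<K>; C \<in> \<K>; f \<in> Epi A B; g \<in> Epi B C\<rbrakk>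
      \<Longrightarrow> compose (verts A) g f \<in> Epi A C"
    and right_factor: "\<lbrakk>A \<in> \<K>; B \<in> \<K>; C \<in> \<K>; f \<in> Epi A B; h \<in> Epi A C;
        g \<in> verts B \<rightarrow>\<^sub>E verts C; h = compose (verts A) g f\<rbrakk> \<Longrightarrow> g \<in> Epi B C"
    and joint_projection: "\<lbrakk>A \<in> \<K>; B \<in> \<K>\<rbrakk>
      \<Longrightarrow> \<exists>C\<in>\<K>. Epi C A \<noteq> {} \<and> Epi C B \<noteq> {}"
    and amalgamation: "\<lbrakk>A \<in> \<K>; B \<in> \<K>; C \<in> \<K>; f \<in> Epi B A; g \<in> Epi C A\<rbrakk>
      \<Longrightarrow> \<exists>D\<in>\<K>. \<exists>f'\<in>Epi D B. \<exists>g'\<in>Epi D C. compose (verts D) f f' = compose (verts D) g g'"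

text \<open>\<open>bond A \<pi> m k\<close> is \<open>\<pi> m \<circ> \<dots> \<circ> \<pi> (m + k - 1)\<close>, defined on the vertices of \<open>A (m + k)\<close>.\<close>

fun bond :: "(nat \<Rightarrow> 'v rgraph) \<Rightarrow> (nat \<Rightarrow> 'v \<Rightarrow> 'v) \<Rightarrow> nat \<Rightarrow> nat \<Rightarrow> 'v \<Rightarrow> 'v" where
  "bond A \<pi> m 0 = (\<lambda>x\<in>verts (A m). x)"
| "bond A \<pi> m (Suc k) = compose (verts (A (m + Suc k))) (bond A \<pi> m k) (\<pi> (m + k))"

locale generic_sequence = projective_fraisse_class +
  fixes A :: "nat \<Rightarrow> 'v rgraph" and \<pi> :: "nat \<Rightarrow> 'v \<Rightarrow> 'v"
  assumes seq_objects: "A m \<in> \<K>"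
    and seq_maps: "\<pi> m \<in> Epi (A (Suc m)) (A m)"
    and cofinal: "B \<in> \<K> \<Longrightarrow> \<exists>m. Epi (A m) B \<noteq> {}"
    and absorbing: "\<lbrakk>B \<in> \<K>; f \<in> Epi B (A m)\<rbrakk>
      \<Longrightarrow> \<exists>n>m. \<exists>g\<in>Epi (A n) B. compose (verts (A n)) f g = bond A \<pi> m (n - m)"

definition lim_set :: "(nat \<Rightarrow> 'v rgraph) \<Rightarrow> (nat \<Rightarrow> 'v \<Rightarrow> 'v) \<Rightarrow> (nat \<Rightarrow> 'v) set" where
  "lim_set A \<pi> = {x. \<forall>i. x i \<in> verts (A i) \<and> \<pi> i (x (Suc i)) = x i}"

definition lim_top :: "(nat \<Rightarrow> 'v rgraph) \<Rightarrow> (nat \<Rightarrow> 'v \<Rightarrow> 'v) \<Rightarrow> (nat \<Rightarrow> 'v) topology" where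
  "lim_top A \<pi> =
     subtopology (product_topology (\<lambda>i. discrete_topology (verts (A i))) UNIV) (lim_set A \<pi>)"

lemma topspace_lim_top [simp]: "topspace (lim_top A \<pi>) = lim_set A \<pi>"
  by (auto simp: lim_top_def lim_set_def)

text \<open>The projection to \<open>A n\<close> is evaluation at \<open>n\<close>.\<close>

definition lim_Epi ::
    "('v rgraph \<Rightarrow> 'v rgraph \<Rightarrow> ('v \<Rightarrow> 'v) set) \<Rightarrow> (nat \<Rightarrow> 'v rgraph) \<Rightarrow> (nat \<Rightarrow> 'v \<Rightarrow> 'v) \<Rightarrow>
     'v rgraph \<Rightarrow> ((nat \<Rightarrow> 'v) \<Rightarrow> 'v) set" where
  "lim_Epi Epi A \<pi> B = {(\<lambda>x\<in>lim_set A \<pi>. f (x n)) | f n. f \<in> Epi (A n) B}"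

definition lim_rel ::
    "'v rgraph set \<Rightarrow> ('v rgraph \<Rightarrow> 'v rgraph \<Rightarrow> ('v \<Rightarrow> 'v) set) \<Rightarrow>
     (nat \<Rightarrow> 'v rgraph) \<Rightarrow> (nat \<Rightarrow> 'v \<Rightarrow> 'v) \<Rightarrow> (nat \<Rightarrow> 'v) rel" where
  "lim_rel \<K> Epi A \<pi> = {(x, y). x \<in> lim_set A \<pi> \<and> y \<in> lim_set A \<pi> \<and>
     (\<forall>B\<in>\<K>. \<forall>\<phi>\<in>lim_Epi Epi A \<pi> B. (\<phi> x, \<phi> y) \<in> adj B)}"

definition aut ::
    "'v rgraph set \<Rightarrow> ('v rgraph \<Rightarrow> 'v rgraph \<Rightarrow> ('v \<Rightarrow> 'v) set) \<Rightarrow>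
     (nat \<Rightarrow> 'v rgraph) \<Rightarrow> (nat \<Rightarrow> 'v \<Rightarrow> 'v) \<Rightarrow> ((nat \<Rightarrow> 'v) \<Rightarrow> nat \<Rightarrow> 'v) set" where
  "aut \<K> Epi A \<pi> = {\<sigma> \<in> Homeo (lim_top A \<pi>). \<forall>B\<in>\<K>. \<forall>\<phi>\<in>lim_Epi Epi A \<pi> B.
     compose (lim_set A \<pi>) \<phi> \<sigma> \<in> lim_Epi Epi A \<pi> B \<and>
     compose (lim_set A \<pi>) \<phi> (inv_into (lim_set A \<pi>) \<sigma>) \<in> lim_Epi Epi A \<pi> B}"

definition aut_group ::
    "'v rgraph set \<Rightarrow> ('v rgraph \<Rightarrow> 'v rgraph \<Rightarrow> ('v \<Rightarrow> 'v) set) \<Rightarrow>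
     (nat \<Rightarrow> 'v rgraph) \<Rightarrow> (nat \<Rightarrow> 'v \<Rightarrow> 'v) \<Rightarrow> ((nat \<Rightarrow> 'v) \<Rightarrow> nat \<Rightarrow> 'v) monoid" where
  "aut_group \<K> Epi A \<pi> = (BijGroup (lim_set A \<pi>)) \<lparr>carrier := aut \<K> Epi A \<pi>\<rparr>"

definition aut_top ::
    "'v rgraph set \<Rightarrow> ('v rgraph \<Rightarrow> 'v rgraph \<Rightarrow> ('v \<Rightarrow> 'v) set) \<Rightarrow>
     (nat \<Rightarrow> 'v rgraph) \<Rightarrow> (nat \<Rightarrow> 'v \<Rightarrow> 'v) \<Rightarrow> ((nat \<Rightarrow> 'v) \<Rightarrow> nat \<Rightarrow> 'v) topology" where
  "aut_top \<K> Epi A \<pi> = subtopology (uniform_topology (lim_top A \<pi>)) (aut \<K> Epi A \<pi>)"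

definition quot_top ::
    "'v rgraph set \<Rightarrow> ('v rgraph \<Rightarrow> 'v rgraph \<Rightarrow> ('v \<Rightarrow> 'v) set) \<Rightarrow>
     (nat \<Rightarrow> 'v rgraph) \<Rightarrow> (nat \<Rightarrow> 'v \<Rightarrow> 'v) \<Rightarrow> (nat \<Rightarrow> 'v) set topology" where
  "quot_top \<K> Epi A \<pi> = quotient_topology (lim_top A \<pi>) (lim_rel \<K> Epi A \<pi>)"

text \<open>When the relation is transitive, this is the map sending the class of \<open>x\<close> to the class of
  \<open>\<sigma> x\<close>: see \<open>pr_aut_class\<close> below.\<close>

definition pr_aut ::
    "'v rgraph set \<Rightarrow> ('v rgraph \<Rightarrow> 'v rgraph \<Rightarrow> ('v \<Rightarrow> 'v) set) \<Rightarrow>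
     (nat \<Rightarrow> 'v rgraph) \<Rightarrow> (nat \<Rightarrow> 'v \<Rightarrow> 'v) \<Rightarrow>
     ((nat \<Rightarrow> 'v) \<Rightarrow> nat \<Rightarrow> 'v) \<Rightarrow> (nat \<Rightarrow> 'v) set \<Rightarrow> (nat \<Rightarrow> 'v) set" where
  "pr_aut \<K> Epi A \<pi> \<sigma> =
     (\<lambda>c \<in> lim_set A \<pi> // lim_rel \<K> Epi A \<pi>. lim_rel \<K> Epi A \<pi> `` (\<sigma> ` c))"

lemma (in generic_sequence) equiv_lim_rel:
  assumes "trans (lim_rel \<K> Epi A \<pi>)"
  shows "equiv (lim_set A \<pi>) (lim_rel \<K> Epi A \<pi>)"
proof (rule equivI)
  have val: "\<phi> x \<in> verts B" if "B \<in> \<K>" "\<phi> \<in> lim_Epi Epi A \<pi> B" "x \<in> lim_set A \<pi>" for B \<phi> x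
    using that Epi_strong [OF seq_objects \<open>B \<in> \<K>\<close>]
    by (fastforce simp: lim_Epi_def lim_set_def strong_hom_def)
  show "refl_on (lim_set A \<pi>) (lim_rel \<K> Epi A \<pi>)"
    using graphs val by (auto simp: refl_on_def lim_rel_def finite_reflexive_graph_def)
  show "sym (lim_rel \<K> Epi A \<pi>)"
    using graphs by (auto simp: sym_def lim_rel_def finite_reflexive_graph_def)
  show "lim_rel \<K> Epi A \<pi> \<subseteq> lim_set A \<pi> \<times> lim_set A \<pi>" by (auto simp: lim_rel_def)
qed (rule assms)

lemma (in generic_sequence) pr_aut_class:
  assumes tr: "trans (lim_rel \<K> Epi A \<pi>)"
    and \<sigma>: "\<sigma> \<in> aut \<K> Epi A \<pi>" and x: "x \<in> lim_set A \<pi>"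
  shows "pr_aut \<K> Epi A \<pi> \<sigma> (lim_rel \<K> Epi A \<pi> `` {x}) = lim_rel \<K> Epi A \<pi> `` {\<sigma> x}"
proof -
  let ?R = "lim_rel \<K> Epi A \<pi>"
  have eq: "equiv (lim_set A \<pi>) ?R" by (rule equiv_lim_rel [OF tr])
  have maps: "\<sigma> u \<in> lim_set A \<pi>" if "u \<in> lim_set A \<pi>" for u
    using \<sigma> that homeomorphic_imp_surjective_map [of "lim_top A \<pi>" "lim_top A \<pi>" \<sigma>]
    by (auto simp: aut_def Homeo_def)
  have pres: "(\<sigma> u, \<sigma> v) \<in> ?R" if uv: "(u, v) \<in> ?R" for u v
  proof -
    have u: "u \<in> lim_set A \<pi>" and v: "v \<in> lim_set A \<pi>" using uv by (auto simp: lim_rel_def)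
    have "(\<phi> (\<sigma> u), \<phi> (\<sigma> v)) \<in> adj B" if "B \<in> \<K>" "\<phi> \<in> lim_Epi Epi A \<pi> B" for B \<phi>
    proof -
      have "compose (lim_set A \<pi>) \<phi> \<sigma> \<in> lim_Epi Epi A \<pi> B" using \<sigma> that by (auto simp: aut_def)
      then have "(compose (lim_set A \<pi>) \<phi> \<sigma> u, compose (lim_set A \<pi>) \<phi> \<sigma> v) \<in> adj B"
        using uv that by (auto simp: lim_rel_def)
      then show ?thesis using u v by (simp add: compose_eq)
    qed
    then show ?thesis using maps u v by (auto simp: lim_rel_def)
  qed
  have "?R `` (\<sigma> ` (?R `` {x})) = ?R `` {\<sigma> x}"
  proof
    show "?R `` (\<sigma> ` (?R `` {x})) \<subseteq> ?R `` {\<sigma> x}"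
      using pres tr by (auto dest: transD)
    have "(x, x) \<in> ?R" using eq x by (meson equiv_def refl_onD)
    then show "?R `` {\<sigma> x} \<subseteq> ?R `` (\<sigma> ` (?R `` {x}))" by blast
  qed
  then show ?thesis using x by (simp add: pr_aut_def quotientI)
qed

type_synonym 'v psystem =
  "'v rgraph \<times> 'v rgraph \<times> (nat \<Rightarrow> 'v \<Rightarrow> 'v) \<times> (nat \<Rightarrow> 'v \<Rightarrow> 'v)"

definition psystems ::
    "'v rgraph set \<Rightarrow> ('v rgraph \<Rightarrow> 'v rgraph \<Rightarrow> ('v \<Rightarrow> 'v) set) \<Rightarrow> nat \<Rightarrow> 'v psystem set" where
  "psystems \<K> Epi n = {(A, B, f, g). A \<in> \<K> \<and> B \<in> \<K> \<and>
     f \<in> {..<n} \<rightarrow>\<^sub>E Epi A B \<and> g \<in> {..<n} \<rightarrow>\<^sub>E Epi A B}"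

fun psys_epi ::
    "('v rgraph \<Rightarrow> 'v rgraph \<Rightarrow> ('v \<Rightarrow> 'v) set) \<Rightarrow> nat \<Rightarrow> 'v psystem \<Rightarrow> 'v psystem \<Rightarrow>
     ('v \<Rightarrow> 'v) set" where
  "psys_epi Epi n (A, B, f, g) (A', B', f', g') = {\<alpha> \<in> Epi A A'.
     \<forall>i<n. \<forall>a\<^sub>0\<in>verts A. \<forall>a\<^sub>1\<in>verts A. f i a\<^sub>0 = g i a\<^sub>1 \<longrightarrow> f' i (\<alpha> a\<^sub>0) = g' i (\<alpha> a\<^sub>1)}"

fun psys_approx_epi ::
    "('v rgraph \<Rightarrow> 'v rgraph \<Rightarrow> ('v \<Rightarrow> 'v) set) \<Rightarrow> nat \<Rightarrow> 'v psystem \<Rightarrow> 'v psystem \<Rightarrow>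
     ('v \<Rightarrow> 'v) set" where
  "psys_approx_epi Epi n (A, B, f, g) (A', B', f', g') = {\<alpha> \<in> Epi A A'.
     \<forall>i<n. \<forall>a\<^sub>0\<in>verts A. \<forall>a\<^sub>1\<in>verts A.
       f i a\<^sub>0 = g i a\<^sub>1 \<longrightarrow> (f' i (\<alpha> a\<^sub>0), g' i (\<alpha> a\<^sub>1)) \<in> adj B'}"

definition psys_JPP ::
    "'v rgraph set \<Rightarrow> ('v rgraph \<Rightarrow> 'v rgraph \<Rightarrow> ('v \<Rightarrow> 'v) set) \<Rightarrow> nat \<Rightarrow> bool" where
  "psys_JPP \<K> Epi n \<longleftrightarrow> (\<forall>X\<in>psystems \<K> Epi n. \<forall>X'\<in>psystems \<K> Epi n.
     \<exists>Z\<in>psystems \<K> Epi n. \<exists>\<alpha> \<alpha>'. \<alpha> \<in> psys_epi Epi n Z X \<and> \<alpha>' \<in> psys_epi Epi n Z X')"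

definition psys_half_approx_JPP ::
    "'v rgraph set \<Rightarrow> ('v rgraph \<Rightarrow> 'v rgraph \<Rightarrow> ('v \<Rightarrow> 'v) set) \<Rightarrow> nat \<Rightarrow> bool" where
  "psys_half_approx_JPP \<K> Epi n \<longleftrightarrow> (\<forall>X\<in>psystems \<K> Epi n. \<forall>X'\<in>psystems \<K> Epi n.
     \<exists>Z\<in>psystems \<K> Epi n. \<exists>\<alpha> \<alpha>'. \<alpha> \<in> psys_epi Epi n Z X \<and> \<alpha>' \<in> psys_approx_epi Epi n Z X')"

definition psys_approx_JPP ::
    "'v rgraph set \<Rightarrow> ('v rgraph \<Rightarrow> 'v rgraph \<Rightarrow> ('v \<Rightarrow> 'v) set) \<Rightarrow> nat \<Rightarrow> bool" where
  "psys_approx_JPP \<K> Epi n \<longleftrightarrow> (\<forall>X\<in>psystems \<K> Epi n. \<forall>X'\<in>psystems \<K> Epi n.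
     \<exists>Z\<in>psystems \<K> Epi n. \<exists>\<alpha> \<alpha>'. \<alpha> \<in> psys_approx_epi Epi n Z X \<and>
       \<alpha>' \<in> psys_approx_epi Epi n Z X')"

end

theory Submission
  imports Defs
begin

text \<open>Given an object \<open>(B, C, f, g)\<close> and an epimorphism \<open>\<phi>\<close> from the limit to \<open>B\<close>, the tuples
  \<open>\<sigma>\<close> of automorphisms with \<open>f\<^sub>i \<circ> \<phi> = g\<^sub>i \<circ> \<phi> \<circ> \<sigma>\<^sub>i\<close> form an open set, which is nonempty by projective
  homogeneity (a back-and-forth along the generic sequence). A tuple \<open>\<gamma>\<close> with dense conjugacy class is
  conjugate into any such set, and the conjugating element can be moved into \<open>\<phi>\<close>. Thus one \<open>\<gamma>\<close>
  realises two given objects at once, and approximating the limit and \<open>\<gamma>\<close> by some \<open>A\<^sub>k\<close> yields an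
  object that maps to both. On the quotient, equality can only be required up to the
  relation of \<open>C\<close>; the resulting sets of homeomorphisms are still open, and a conjugating homeomorphism
  is approximated by an automorphism. For the half-approximate version, the Baire category theorem
  in the completely metrizable group of automorphisms gives a \<open>\<gamma>\<close> that realises the first object exactly.\<close>

subsection \<open>Groups of homeomorphisms\<close>

text \<open>The object that \<open>common_psystem\<close> reads off from a tuple of automorphisms
  inherits every condition relating \<open>\<phi> x\<close> to \<open>\<phi> (\<delta> i x)\<close>,
  exact or approximate. Conjugation serves only to find, for one tuple, suitable maps to both given
  objects.

  The obstacle on the quotient is that its homeomorphisms do not act on points of the limit and
  cannot be composed with an epimorphism to a finite graph. Conditions are therefore imposed on
  pairs of classes: all pairs of representatives must have adjacent values. An automorphism
  satisfying the exact equation meets this with one adjacency step. As adjacency in a finite graph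
  need not be transitive, no second step may be added later; none is, because each replacement of a
  homeomorphism by an automorphism takes place inside an open set defined by the same
  condition.\<close>

lemma Homeo_continuous_map: "f \<in> Homeo X \<Longrightarrow> continuous_map X X f"
  by (simp add: Homeo_def homeomorphic_imp_continuous_map)

lemma Homeo_bij_betw: "f \<in> Homeo X \<Longrightarrow> bij_betw f (topspace X) (topspace X)"
  by (simp add: Homeo_def bij_betw_def homeomorphic_eq_everything_map)

lemma Homeo_in: "\<lbrakk>f \<in> Homeo X; x \<in> topspace X\<rbrakk> \<Longrightarrow> f x \<in> topspace X"
  using Homeo_bij_betw bij_betwE by blast

lemma Homeo_Bij: "Homeo X \<subseteq> Bij (topspace X)"
  using Homeo_bij_betw by (auto simp: Bij_def Homeo_def)

lemma Homeo_inverse: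
  assumes "f \<in> Homeo X"
  obtains g where "continuous_map X X g"
    "\<And>x. x \<in> topspace X \<Longrightarrow> g (f x) = x" "\<And>x. x \<in> topspace X \<Longrightarrow> f (g x) = x"
  using assms unfolding Homeo_def homeomorphic_map_maps homeomorphic_maps_def by blast

lemma Homeo_inv_into:
  assumes f: "f \<in> Homeo X"
  shows "restrict (inv_into (topspace X) f) (topspace X) \<in> Homeo X"
proof -
  obtain g where g: "homeomorphic_maps X X f g"
    using f by (auto simp: Homeo_def homeomorphic_map_maps)
  then have fg: "\<And>x. x \<in> topspace X \<Longrightarrow> g (f x) = x" "\<And>x. x \<in> topspace X \<Longrightarrow> f (g x) = x"
    "\<And>x. x \<in> topspace X \<Longrightarrow> g x \<in> topspace X"
    by (auto simp: homeomorphic_maps_def continuous_map_def)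
  have "g x = restrict (inv_into (topspace X) f) (topspace X) x" if "x \<in> topspace X" for x
    using that fg Homeo_bij_betw [OF f] by (metis restrict_apply' bij_betw_def inv_into_f_f)
  moreover have "homeomorphic_map X X g"
    using g homeomorphic_maps_sym homeomorphic_maps_imp_map by blast
  ultimately have "homeomorphic_map X X (restrict (inv_into (topspace X) f) (topspace X))"
    using homeomorphic_map_eq by blast
  then show ?thesis by (simp add: Homeo_def)
qed

text \<open>Since \<open>f\<close> is onto, a neighbourhood \<open>W\<close> of its graph becomes a
  neighbourhood of the diagonal when pulled back along \<open>(g, id)\<close>, where
  \<open>g\<close> is the inverse of \<open>f\<close>. Tested on \<open>(f u, h u)\<close>, this
  entourage says exactly \<open>(u, h u) \<in> W\<close>.\<close>

lemma openin_uniform_pointwise: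
  assumes W: "openin (prod_topology X X) W"
  shows "openin (uniform_topology X) {h \<in> Homeo X. \<forall>u\<in>topspace X. (u, h u) \<in> W}"
  unfolding openin_uniform_topology
proof (intro conjI ballI)
  fix f assume f: "f \<in> {h \<in> Homeo X. \<forall>u\<in>topspace X. (u, h u) \<in> W}"
  then obtain g where g: "continuous_map X X g"
    "\<And>x. x \<in> topspace X \<Longrightarrow> g (f x) = x" "\<And>x. x \<in> topspace X \<Longrightarrow> f (g x) = x"
    using Homeo_inverse by blast
  have gX: "g x \<in> topspace X" if "x \<in> topspace X" for x
    using g(1) that by (auto simp: continuous_map_def)
  let ?E = "{z \<in> topspace (prod_topology X X). (g (fst z), snd z) \<in> W}"
  have "continuous_map (prod_topology X X) (prod_topology X X) (\<lambda>z. (g (fst z), snd z))"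
    by (intro continuous_map_pairedI continuous_map_snd
        continuous_map_compose [OF continuous_map_fst g(1), unfolded o_def])
  then have "openin (prod_topology X X) ?E"
    by (rule openin_continuous_map_preimage [OF _ W])
  moreover have "(x, x) \<in> ?E" if "x \<in> topspace X" for x
    using f g(3) gX that by force
  moreover have "{h \<in> Homeo X. \<forall>x\<in>topspace X. (f x, h x) \<in> ?E}
      \<subseteq> {h \<in> Homeo X. \<forall>u\<in>topspace X. (u, h u) \<in> W}"
    using g(2) by auto
  ultimately show "\<exists>E. entourage X E \<and> {h \<in> Homeo X. \<forall>x\<in>topspace X. (f x, h x) \<in> E}
      \<subseteq> {h \<in> Homeo X. \<forall>u\<in>topspace X. (u, h u) \<in> W}"
    unfolding entourage_def by blast
qed blast

text \<open>A perturbation \<open>h'\<close> of \<open>h\<close> moves both entries of \<open>(h u, h (\<gamma> u))\<close>: the second one is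
  absorbed by a closed neighbourhood of the graph of \<open>h \<circ> \<gamma> \<circ> h\<inverse>\<close> inside \<open>W\<close>, the first one by
  compactness, which makes projections closed.\<close>

lemma openin_uniform_conj:
  assumes X: "compact_space X" "Hausdorff_space X" and \<gamma>: "\<gamma> \<in> Homeo X"
    and W: "openin (prod_topology X X) W"
  shows "openin (uniform_topology X) {h \<in> Homeo X. \<forall>u\<in>topspace X. (h u, h (\<gamma> u)) \<in> W}"
  unfolding openin_uniform_topology
proof (intro conjI ballI)
  let ?XX = "prod_topology X X"
  fix h assume h: "h \<in> {h \<in> Homeo X. \<forall>u\<in>topspace X. (h u, h (\<gamma> u)) \<in> W}"
  then have hH: "h \<in> Homeo X" by simp
  obtain k where k: "continuous_map X X k"
    "\<And>x. x \<in> topspace X \<Longrightarrow> k (h x) = x" "\<And>x. x \<in> topspace X \<Longrightarrow> h (k x) = x"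
    using Homeo_inverse [OF hH] by blast
  obtain \<delta> where \<delta>: "continuous_map X X \<delta>"
    "\<And>x. x \<in> topspace X \<Longrightarrow> \<delta> (\<gamma> x) = x" "\<And>x. x \<in> topspace X \<Longrightarrow> \<gamma> (\<delta> x) = x"
    using Homeo_inverse [OF \<gamma>] by blast
  have inX: "k x \<in> topspace X" "\<delta> x \<in> topspace X" "h x \<in> topspace X" "\<gamma> x \<in> topspace X"
    if "x \<in> topspace X" for x
    using k(1) \<delta>(1) Homeo_in hH \<gamma> that by (auto simp: continuous_map_def)
  let ?G = "(\<lambda>u. (h u, h (\<gamma> u))) ` topspace X"
  have cont: "continuous_map X ?XX (\<lambda>u. (h u, h (\<gamma> u)))"
    by (intro continuous_map_pairedI Homeo_continuous_map hH
        continuous_map_compose [OF Homeo_continuous_map [OF \<gamma>], unfolded o_def])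
  have cXX: "compact_space ?XX" and hXX: "Hausdorff_space ?XX"
    using X by (simp_all add: compact_space_prod_topology Hausdorff_space_prod_topology)
  have "compactin ?XX ?G"
    using image_compactin [OF _ cont] X(1) by (simp add: compact_space_def)
  then have G: "closedin ?XX ?G" using hXX compactin_imp_closedin by blast
  have "normal_space ?XX" using cXX hXX compact_Hausdorff_or_regular_imp_normal_space by blast
  then obtain V where V: "openin ?XX V" "?G \<subseteq> V" "?XX closure_of V \<subseteq> W"
    using G W h unfolding normal_space_alt
    by (metis (no_types, lifting) image_subsetI mem_Collect_eq)
  let ?C = "?XX closure_of V"
  have clC: "closedin ?XX ?C" by simp
  have VC: "V \<subseteq> ?C" by (rule Abstract_Topology.closure_of_subset [OF openin_subset [OF V(1)]])
  \<comment> \<open>Outside the image of \<open>?B\<close> under \<open>fst\<close> lie the pairs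
    \<open>(a, b)\<close> such that, for every point \<open>c\<close>,
    \<open>(a, c) \<in> ?C\<close> implies \<open>(b, c) \<in> W\<close>. This is used with
    \<open>a = h u\<close>, \<open>b = h' u\<close>, \<open>c = h' (\<gamma> u)\<close>.\<close>
  let ?B = "{z \<in> topspace (prod_topology ?XX X).
    (fst (fst z), snd z) \<in> ?C \<and> (snd (fst z), snd z) \<in> topspace ?XX - W}"
  have B1: "closedin (prod_topology ?XX X)
      {z \<in> topspace (prod_topology ?XX X). (fst (fst z), snd z) \<in> ?C}"
    by (rule closedin_continuous_map_preimage [OF _ clC])
      (intro continuous_map_pairedI continuous_map_snd
        continuous_map_compose [OF continuous_map_fst continuous_map_fst, unfolded o_def])
  have B2: "closedin (prod_topology ?XX X)
      {z \<in> topspace (prod_topology ?XX X). (snd (fst z), snd z) \<in> topspace ?XX - W}"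
    by (rule closedin_continuous_map_preimage [OF _ closedin_diff [OF closedin_topspace W]])
      (intro continuous_map_pairedI continuous_map_snd
        continuous_map_compose [OF continuous_map_fst continuous_map_snd, unfolded o_def])
  have "closedin (prod_topology ?XX X) ?B"
    using closedin_Int [OF B1 B2] by (rule back_subst [of "closedin _"]) blast
  then have "closedin ?XX (fst ` ?B)"
    using Abstract_Topological_Spaces.closed_map_fst [OF X(1), of ?XX]
    unfolding closed_map_def by blast
  then have E1: "openin ?XX (topspace ?XX - fst ` ?B)" by blast
  \<comment> \<open>At \<open>x = h (\<gamma> u)\<close> the map
    \<open>h \<circ> \<delta> \<circ> k\<close> returns \<open>h u\<close>, so
    \<open>(x, h' x) \<in> ?E2\<close> yields \<open>(h u, h' (\<gamma> u)) \<in> V\<close>.\<close>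
  let ?E2 = "{z \<in> topspace ?XX. (h (\<delta> (k (fst z))), snd z) \<in> V}"
  have E2: "openin ?XX ?E2"
    by (rule openin_continuous_map_preimage [OF _ V(1)])
      (intro continuous_map_pairedI continuous_map_snd Homeo_continuous_map hH
        continuous_map_compose [OF continuous_map_compose [OF continuous_map_compose
          [OF continuous_map_fst k(1)] \<delta>(1)] Homeo_continuous_map [OF hH], unfolded o_def])
  let ?E = "(topspace ?XX - fst ` ?B) \<inter> ?E2"
  have "(x, x) \<in> ?E" if x: "x \<in> topspace X" for x
  proof
    show "(x, x) \<in> topspace ?XX - fst ` ?B"
      using x V(3) by auto
    have "(h (\<delta> (k x)), h (\<gamma> (\<delta> (k x)))) \<in> V"
      using V(2) inX x by blast
    then show "(x, x) \<in> ?E2" using x \<delta>(3) k(3) inX by simp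
  qed
  then have "entourage X ?E" using E1 E2 by (auto simp: entourage_def)
  moreover have "{h' \<in> Homeo X. \<forall>x\<in>topspace X. (h x, h' x) \<in> ?E}
      \<subseteq> {h \<in> Homeo X. \<forall>u\<in>topspace X. (h u, h (\<gamma> u)) \<in> W}"
  proof clarify
    fix h' u
    assume h': "h' \<in> Homeo X" "\<forall>x\<in>topspace X. (h x, h' x) \<in> ?E" and u: "u \<in> topspace X"
    have "(h (\<gamma> u), h' (\<gamma> u)) \<in> ?E2" using h' inX u by blast
    then have "(h u, h' (\<gamma> u)) \<in> ?C" using k(2) \<delta>(2) inX u VC by auto
    moreover have "(h u, h' u) \<notin> fst ` ?B" using h'(2) u by blast
    moreover have "h' u \<in> topspace X" "h' (\<gamma> u) \<in> topspace X" using Homeo_in h' inX u by auto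
    ultimately show "(h' u, h' (\<gamma> u)) \<in> W"
      using inX u by (force simp: image_iff)
  qed
  ultimately show "\<exists>E. entourage X E \<and> {h' \<in> Homeo X. \<forall>x\<in>topspace X. (h x, h' x) \<in> E}
      \<subseteq> {h \<in> Homeo X. \<forall>u\<in>topspace X. (h u, h (\<gamma> u)) \<in> W}"
    by blast
qed blast

section \<open>Dense sets in finite powers, conjugacy classes and category\<close>

lemma dense_in_meets:
  "\<lbrakk>dense_in X S; openin X U; x \<in> U\<rbrakk> \<Longrightarrow> \<exists>y\<in>S. y \<in> U"
  unfolding dense_in_def dense_intersects_open by (metis Int_emptyI empty_iff)

lemma dense_in_power_meets:
  assumes "dense_in (power_topology X n) S"
    and "\<And>i. i < n \<Longrightarrow> openin X (U i)" "\<And>i. i < n \<Longrightarrow> U i \<noteq> {}"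
  obtains y where "y \<in> S" "\<And>i. i < n \<Longrightarrow> y i \<in> U i"
proof -
  let ?P = "PiE {..<n} U"
  have "openin (power_topology X n) ?P"
    using assms(2) by (simp add: power_topology_def openin_PiE_gen)
  moreover have "?P \<noteq> {}" using assms(3) by (auto simp: PiE_eq_empty_iff)
  ultimately obtain y where "y \<in> S" "y \<in> ?P"
    using dense_in_meets [OF assms(1)] by blast
  then show thesis using that by auto
qed

lemma openin_uniform_all_less:
  assumes "\<And>i. i < n \<Longrightarrow> openin (uniform_topology X) {h \<in> Homeo X. P i h}"
  shows "openin (uniform_topology X) {h \<in> Homeo X. \<forall>i<(n::nat). P i h}"
proof -
  \<comment> \<open>Intersecting with the whole space matters for \<open>n = 0\<close>, where the
    intersection alone is \<open>UNIV\<close>.\<close>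
  have "openin (uniform_topology X) ((\<Inter>i\<in>{..<n}. {h \<in> Homeo X. P i h})
      \<inter> topspace (uniform_topology X))"
    using assms by (intro openin_INT) auto
  also have "\<dots> = {h \<in> Homeo X. \<forall>i<n. P i h}" by auto
  finally show ?thesis .
qed

text \<open>\<open>m_inv\<close> is a definite description, which denotes the inverse map only if the carrier contains it.\<close>

lemma conj_class_commute:
  assumes S: "S \<subseteq> Bij Y" "\<And>g. g \<in> S \<Longrightarrow> restrict (inv_into Y g) Y \<in> S"
    and \<tau>: "\<tau> \<in> conj_class ((BijGroup Y)\<lparr>carrier := S\<rparr>) n \<gamma>"
    and \<gamma>: "\<And>i. i < n \<Longrightarrow> \<gamma> i \<in> S"
  obtains g where "g \<in> S" "\<And>i x. \<lbrakk>i < n; x \<in> Y\<rbrakk> \<Longrightarrow> \<tau> i (g x) = g (\<gamma> i x)"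
proof -
  let ?G = "(BijGroup Y)\<lparr>carrier := S\<rparr>"
  obtain g where g: "g \<in> S" "\<tau> = (\<lambda>j\<in>{..<n}. g \<otimes>\<^bsub>?G\<^esub> \<gamma> j \<otimes>\<^bsub>?G\<^esub> inv\<^bsub>?G\<^esub> g)"
    using \<tau> by (auto simp: conj_class_def)
  let ?k = "restrict (inv_into Y g) Y"
  have gB: "g \<in> Bij Y" and kB: "?k \<in> Bij Y" using g S by auto
  have kg: "?k (g x) = x" "g x \<in> Y" if "x \<in> Y" for x
    using gB that by (auto simp: Bij_def bij_betw_def)
  have gk: "g (?k x) = x" if "x \<in> Y" for x
    using gB that by (auto simp: Bij_def bij_betw_def f_inv_into_f)
  have inv: "inv\<^bsub>?G\<^esub> g = ?k"
    unfolding m_inv_def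
  proof (rule the_equality)
    show "?k \<in> carrier ?G \<and> g \<otimes>\<^bsub>?G\<^esub> ?k = \<one>\<^bsub>?G\<^esub> \<and> ?k \<otimes>\<^bsub>?G\<^esub> g = \<one>\<^bsub>?G\<^esub>"
      using S g gB kB gk kg by (auto simp: BijGroup_def compose_def fun_eq_iff)
    fix y assume y: "y \<in> carrier ?G \<and> g \<otimes>\<^bsub>?G\<^esub> y = \<one>\<^bsub>?G\<^esub> \<and> y \<otimes>\<^bsub>?G\<^esub> g = \<one>\<^bsub>?G\<^esub>"
    then have yB: "y \<in> Bij Y" using S by auto
    then have "compose Y g y = (\<lambda>x\<in>Y. x)" using y gB by (simp add: BijGroup_def)
    then have "g (y x) = x" if "x \<in> Y" for x using that by (metis compose_eq restrict_apply')
    moreover have "y x \<in> Y" if "x \<in> Y" for x using that yB Bij_imp_funcset by blast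
    ultimately have "y x = ?k x" if "x \<in> Y" for x using that kg(1) by metis
    then show "y = ?k"
      using Bij_imp_extensional [OF yB] Bij_imp_extensional [OF kB] by (rule extensionalityI [rotated 2])
  qed
  have "\<tau> i (g x) = g (\<gamma> i x)" if i: "i < n" and x: "x \<in> Y" for i x
  proof -
    have "\<gamma> i \<in> Bij Y" using \<gamma> i S by blast
    then have "\<tau> i = compose Y (compose Y g (\<gamma> i)) ?k"
      using i gB kB compose_Bij [OF gB] by (simp add: g(2) inv) (simp add: BijGroup_def)
    then show ?thesis using kg [OF x] x by (simp add: compose_def)
  qed
  then show thesis using that g(1) by blast
qed

lemma comeager_imp_dense:
  assumes "completely_metrizable_space X" "comeager_in X S"
  shows "dense_in X S"
proof -
  obtain \<U> where \<U>: "countable \<U>" "\<And>U. U \<in> \<U> \<Longrightarrow> openin X U \<and> dense_in X U"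
    "topspace X \<inter> \<Inter>\<U> \<subseteq> S" and S: "S \<subseteq> topspace X"
    using assms(2) unfolding comeager_in_def by blast
  have "X closure_of \<Inter>\<U> = topspace X"
    using \<U>(2) by (intro Baire_category assms disjI1 \<U>(1)) (simp add: dense_in_def)
  then have "topspace X \<subseteq> X closure_of S"
    using \<U>(3) Abstract_Topology.closure_of_mono Abstract_Topology.closure_of_restrict by metis
  then show ?thesis
    using S Abstract_Topology.closure_of_subset_topspace [of X S] by (simp add: dense_in_def)
qed

lemma completely_metrizable_power:
  assumes "completely_metrizable_space X"
  shows "completely_metrizable_space (power_topology X n)"
  unfolding power_topology_def completely_metrizable_space_product_topology
  using assms by (intro disjI2 conjI countable_finite) auto

subsection \<open>The projective limit\<close>

context generic_sequence
begin

abbreviation plim where "plim \<equiv> lim_set A \<pi>"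
abbreviation lim_epi where "lim_epi \<equiv> lim_Epi Epi A \<pi>"
abbreviation auts where "auts \<equiv> aut \<K> Epi A \<pi>"
abbreviation rel where "rel \<equiv> lim_rel \<K> Epi A \<pi>"

lemma Epi_in: "\<lbrakk>f \<in> Epi B C; B \<in> \<K>; C \<in> \<K>; x \<in> verts B\<rbrakk> \<Longrightarrow> f x \<in> verts C"
  using Epi_strong [of B C] by (auto simp: strong_hom_def)

lemma Epi_adj:
  "\<lbrakk>f \<in> Epi B C; B \<in> \<K>; C \<in> \<K>; (x, y) \<in> adj B\<rbrakk> \<Longrightarrow> (f x, f y) \<in> adj C"
  using Epi_strong [of B C] by (auto simp: strong_hom_def)

lemma Epi_surj:
  assumes "f \<in> Epi B C" "B \<in> \<K>" "C \<in> \<K>" "y \<in> verts C"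
  obtains x where "x \<in> verts B" "f x = y"
proof -
  have "(y, y) \<in> adj C" using graphs assms by (auto simp: finite_reflexive_graph_def refl_on_def)
  moreover have "\<forall>(u, v) \<in> adj C. \<exists>(x, y) \<in> adj B. f x = u \<and> f y = v"
    using subsetD [OF Epi_strong [OF assms(2,3)] assms(1)] by (simp add: strong_hom_def)
  ultimately obtain u v where "(u, v) \<in> adj B" "f u = y" by fast
  moreover have "adj B \<subseteq> verts B \<times> verts B" using graphs assms by (auto simp: finite_reflexive_graph_def)
  ultimately show thesis using that by blast
qed

lemma bond_Epi: "bond A \<pi> m k \<in> Epi (A (m + k)) (A m)"
proof (induction k)
  case 0
  show ?case using Epi_id [OF seq_objects, of m] by (simp only: bond.simps add_0_right)
next
  case (Suc k)
  have "\<pi> (m + k) \<in> Epi (A (m + Suc k)) (A (m + k))" using seq_maps [of "m + k"] by simp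
  then have "compose (verts (A (m + Suc k))) (bond A \<pi> m k) (\<pi> (m + k)) \<in> Epi (A (m + Suc k)) (A m)"
    using Epi_comp seq_objects Suc by blast
  then show ?case by simp
qed

lemma lim_in: "x \<in> plim \<Longrightarrow> x i \<in> verts (A i)"
  by (simp add: lim_set_def)

lemma lim_bond: "x \<in> plim \<Longrightarrow> bond A \<pi> m k (x (m + k)) = x m"
proof (induction k)
  case 0
  then show ?case by (simp add: lim_in)
next
  case (Suc k)
  then have "\<pi> (m + k) (x (m + Suc k)) = x (m + k)" by (simp add: lim_set_def)
  then show ?case using Suc lim_in [of x "m + Suc k"] by (simp add: compose_eq)
qed

lemma lim_determines: "\<lbrakk>x \<in> plim; y \<in> plim; x n = y n; m \<le> n\<rbrakk> \<Longrightarrow> x m = y m"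
  using lim_bond [of x m "n - m"] lim_bond [of y m "n - m"] by simp

lemma lim_surj:
  assumes "a \<in> verts (A k)"
  obtains x where "x \<in> plim" "x k = a"
proof -
  have "\<exists>f. f 0 = a \<and> (\<forall>n. (f n \<in> verts (A (k + n))) \<and> \<pi> (k + n) (f (Suc n)) = f n)"
  proof (rule dependent_nat_choice [where P = "\<lambda>n v. (v \<in> verts (A (k + n))) \<and> (n = 0 \<longrightarrow> v = a)"
        and Q = "\<lambda>n v w. \<pi> (k + n) w = v", THEN exE])
    show "\<exists>v. v \<in> verts (A (k + 0)) \<and> (0 = (0::nat) \<longrightarrow> v = a)" using assms by auto
    fix v n assume "v \<in> verts (A (k + n)) \<and> (n = 0 \<longrightarrow> v = a)"
    then obtain w where "w \<in> verts (A (Suc (k + n)))" "\<pi> (k + n) w = v"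
      using Epi_surj [OF seq_maps seq_objects seq_objects] by metis
    then show "\<exists>w. (w \<in> verts (A (k + Suc n)) \<and> (Suc n = 0 \<longrightarrow> w = a)) \<and> \<pi> (k + n) w = v" by auto
  qed blast
  then obtain f where f: "f 0 = a" "\<And>n. f n \<in> verts (A (k + n))"
    "\<And>n. \<pi> (k + n) (f (Suc n)) = f n" by blast
  \<comment> \<open>\<open>f i\<close> lives at level \<open>k + i\<close>, above both
    \<open>i\<close> and \<open>k\<close>; pushing it down to level \<open>i\<close> defines every
    coordinate without a case distinction at \<open>k\<close>.\<close>
  define x where "x i = bond A \<pi> i k (f i)" for i
  have fi: "f i \<in> verts (A (i + k))" for i using f(2) by (simp add: add.commute)
  \<comment> \<open>\<open>bond\<close> recurses at its upper end, while membership in the limit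
    needs the factor \<open>\<pi> i\<close> at the lower end.\<close>
  have step: "\<pi> i (bond A \<pi> (Suc i) l v) = bond A \<pi> i (Suc l) v" if "v \<in> verts (A (i + Suc l))" for i l v
    using that
  proof (induction l arbitrary: v)
    case 0
    then show ?case using Epi_in [OF seq_maps seq_objects seq_objects] by (simp add: compose_eq)
  next
    case (Suc l)
    have "\<pi> (i + Suc l) v \<in> verts (A (i + Suc l))"
      using Epi_in [OF seq_maps seq_objects seq_objects, of v "i + Suc l"] Suc.prems by simp
    then show ?case using Suc by (simp add: compose_eq)
  qed
  have "x i \<in> verts (A i)" for i
    unfolding x_def using Epi_in [OF bond_Epi seq_objects seq_objects fi] .
  moreover have "\<pi> i (x (Suc i)) = x i" for i
  proof -
    have "\<pi> i (x (Suc i)) = bond A \<pi> i (Suc k) (f (Suc i))"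
      unfolding x_def using step [of "f (Suc i)" i k] fi [of "Suc i"] by simp
    also have "\<dots> = bond A \<pi> i k (\<pi> (k + i) (f (Suc i)))"
      using fi [of "Suc i"] by (simp add: compose_eq add.commute)
    finally show ?thesis by (simp add: x_def f(3))
  qed
  ultimately have "x \<in> plim" by (simp add: lim_set_def)
  moreover have "x k = a"
  proof -
    have "bond A \<pi> k l (f l) = a" for l
    proof (induction l)
      case 0
      then show ?case using f(1) assms by simp
    next
      case (Suc l)
      then show ?case using f(2) [of "Suc l"] f(3) by (simp add: compose_eq)
    qed
    then show ?thesis by (simp add: x_def)
  qed
  ultimately show thesis by (rule that)
qed

lemma lim_epiI: "f \<in> Epi (A m) B \<Longrightarrow> (\<lambda>x\<in>plim. f (x m)) \<in> lim_epi B"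
  by (auto simp: lim_Epi_def)

lemma lim_epi_in: "\<lbrakk>\<phi> \<in> lim_epi B; B \<in> \<K>; x \<in> plim\<rbrakk> \<Longrightarrow> \<phi> x \<in> verts B"
  unfolding lim_Epi_def using Epi_in [OF _ seq_objects] lim_in by (smt (verit) mem_Collect_eq restrict_apply')

text \<open>Composing with bonding maps raises the level at will; this lets finitely many maps be
  brought to a common level.\<close>

lemma lim_epi_factor:
  assumes "\<phi> \<in> lim_epi B" "B \<in> \<K>"
  obtains m where "\<And>n. m \<le> n \<Longrightarrow> \<exists>f\<in>Epi (A n) B. \<forall>x\<in>plim. \<phi> x = f (x n)"
proof -
  obtain f m where f: "f \<in> Epi (A m) B" "\<phi> = (\<lambda>x\<in>plim. f (x m))"
    using assms by (auto simp: lim_Epi_def)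
  show thesis
  proof (rule that [of m])
    fix n assume "m \<le> n"
    then have n: "m + (n - m) = n" by simp
    have "compose (verts (A n)) f (bond A \<pi> m (n - m)) \<in> Epi (A n) B"
      using Epi_comp [OF seq_objects seq_objects assms(2) bond_Epi f(1), of "n - m"] n by simp
    moreover have "\<phi> x = compose (verts (A n)) f (bond A \<pi> m (n - m)) (x n)" if "x \<in> plim" for x
      using that f(2) lim_bond [OF that, of m "n - m"] n by (simp add: compose_eq lim_in)
    ultimately show "\<exists>f\<in>Epi (A n) B. \<forall>x\<in>plim. \<phi> x = f (x n)" by blast
  qed
qed

lemma proj_lim_epi: "(\<lambda>x\<in>plim. x m) \<in> lim_epi (A m)"
proof -
  have "(\<lambda>x\<in>plim. (\<lambda>v\<in>verts (A m). v) (x m)) \<in> lim_epi (A m)"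
    by (rule lim_epiI [OF Epi_id [OF seq_objects]])
  also have "(\<lambda>x\<in>plim. (\<lambda>v\<in>verts (A m). v) (x m)) = (\<lambda>x\<in>plim. x m)"
    by (auto simp: lim_in)
  finally show ?thesis .
qed

lemma Epi_lim_epi:
  assumes "f \<in> Epi B C" "\<phi> \<in> lim_epi B" "B \<in> \<K>" "C \<in> \<K>"
  shows "(\<lambda>x\<in>plim. f (\<phi> x)) \<in> lim_epi C"
proof -
  obtain g m where g: "g \<in> Epi (A m) B" "\<phi> = (\<lambda>x\<in>plim. g (x m))"
    using assms by (auto simp: lim_Epi_def)
  have "(\<lambda>x\<in>plim. compose (verts (A m)) f g (x m)) \<in> lim_epi C"
    using lim_epiI Epi_comp [OF seq_objects assms(3,4) g(1) assms(1)] by blast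
  also have "(\<lambda>x\<in>plim. compose (verts (A m)) f g (x m)) = (\<lambda>x\<in>plim. f (\<phi> x))"
    by (auto simp: g(2) compose_eq lim_in)
  finally show ?thesis .
qed

text \<open>Amalgamating \<open>f\<close> with a factor \<open>g\<close> of \<open>\<psi>\<close> at
  level \<open>m\<close> gives \<open>D\<close> over \<open>C\<close> and \<open>A m\<close>; by
  \<open>absorbing\<close>, \<open>q\<close> becomes a bonding map after composition with some
  \<open>r\<close>, so \<open>p \<circ> r\<close> at level \<open>n\<close> is the lift.\<close>

lemma lim_epi_lift:
  assumes B: "B \<in> \<K>" "C \<in> \<K>" and f: "f \<in> Epi C B" and \<psi>: "\<psi> \<in> lim_epi B"
  obtains \<psi>' where "\<psi>' \<in> lim_epi C" "\<And>x. x \<in> plim \<Longrightarrow> f (\<psi>' x) = \<psi> x"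
proof -
  obtain g m where g: "g \<in> Epi (A m) B" "\<psi> = (\<lambda>x\<in>plim. g (x m))"
    using \<psi> by (auto simp: lim_Epi_def)
  obtain D p q where D: "D \<in> \<K>" "p \<in> Epi D C" "q \<in> Epi D (A m)"
    "compose (verts D) f p = compose (verts D) g q"
    using amalgamation [OF B seq_objects f g(1)] by blast
  obtain n r where r: "n > m" "r \<in> Epi (A n) D" "compose (verts (A n)) q r = bond A \<pi> m (n - m)"
    using absorbing [OF D(1,3)] by blast
  have "(\<lambda>x\<in>plim. p (r (x n))) \<in> lim_epi C"
    using Epi_lim_epi [OF D(2) lim_epiI [OF r(2)] D(1) B(2)]
    by (simp cong: restrict_cong)
  moreover have "f (p (r (x n))) = \<psi> x" if x: "x \<in> plim" for x
  proof -
    have rD: "r (x n) \<in> verts D" using Epi_in [OF r(2) seq_objects D(1)] lim_in x by blast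
    have "f (p (r (x n))) = g (q (r (x n)))"
      using fun_cong [OF D(4), of "r (x n)"] rD by (simp add: compose_eq)
    also have "q (r (x n)) = x m"
      using fun_cong [OF r(3), of "x n"] lim_bond [OF x, of m "n - m"] r(1) lim_in [OF x]
      by (simp add: compose_eq)
    finally show ?thesis using x g(2) by simp
  qed
  ultimately show thesis using that [of "\<lambda>x\<in>plim. p (r (x n))"] by simp
qed

subsection \<open>Automorphisms and projective homogeneity\<close>

text \<open>One half of being an automorphism, with the epimorphism condition tested on coordinates
  only: \<open>endo_lim_epi\<close> and \<open>endo_continuous\<close> recover the rest. Values
  outside \<open>plim\<close> are left free, so maps built by choice need no restriction until the
  end.\<close>

definition endo :: "((nat \<Rightarrow> 'v) \<Rightarrow> nat \<Rightarrow> 'v) \<Rightarrow> bool" where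
  "endo s \<longleftrightarrow> (\<forall>x\<in>plim. s x \<in> plim) \<and> (\<forall>m. (\<lambda>x\<in>plim. s x m) \<in> lim_epi (A m))"

lemma endo_in: "\<lbrakk>endo s; x \<in> plim\<rbrakk> \<Longrightarrow> s x \<in> plim"
  by (simp add: endo_def)

lemma endo_lim_epi:
  assumes s: "endo s" and B: "B \<in> \<K>" and \<phi>: "\<phi> \<in> lim_epi B"
  shows "(\<lambda>x\<in>plim. \<phi> (s x)) \<in> lim_epi B"
proof -
  obtain f m where f: "f \<in> Epi (A m) B" "\<phi> = (\<lambda>x\<in>plim. f (x m))"
    using \<phi> by (auto simp: lim_Epi_def)
  have "(\<lambda>x\<in>plim. s x m) \<in> lim_epi (A m)" using s by (simp add: endo_def)
  from Epi_lim_epi [OF f(1) this seq_objects B]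
  have "(\<lambda>x\<in>plim. f (s x m)) \<in> lim_epi B" by (simp cong: restrict_cong)
  also have "(\<lambda>x\<in>plim. f (s x m)) = (\<lambda>x\<in>plim. \<phi> (s x))"
    using endo_in [OF s] by (intro restrict_ext) (simp add: f(2))
  finally show ?thesis .
qed

lemma continuous_map_lim_coord:
  "continuous_map (lim_top A \<pi>) (discrete_topology (verts (A m))) (\<lambda>x. x m)"
  unfolding lim_top_def
  by (rule continuous_map_from_subtopology) (rule continuous_map_product_projection, simp)

lemma continuous_map_lim_epi:
  assumes "\<phi> \<in> lim_epi B" "B \<in> \<K>"
  shows "continuous_map (lim_top A \<pi>) (discrete_topology (verts B)) \<phi>"
proof -
  obtain f m where f: "f \<in> Epi (A m) B" "\<phi> = (\<lambda>x\<in>plim. f (x m))"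
    using assms(1) by (auto simp: lim_Epi_def)
  have "continuous_map (discrete_topology (verts (A m))) (discrete_topology (verts B)) f"
    using Epi_in [OF f(1) seq_objects assms(2)] by auto
  from continuous_map_compose [OF continuous_map_lim_coord this]
  show ?thesis by (rule continuous_map_eq) (simp add: f(2))
qed

text \<open>Both maps are continuous into discrete spaces, so any condition on their values is open.
  Equality, adjacency and the negations of both enter through \<open>P\<close>.\<close>

lemma openin_lim_epi:
  assumes "\<phi> \<in> lim_epi B" "B \<in> \<K>" "\<psi> \<in> lim_epi C" "C \<in> \<K>"
  shows "openin (prod_topology (lim_top A \<pi>) (lim_top A \<pi>))
    {(x, y). x \<in> plim \<and> y \<in> plim \<and> P (\<phi> x) (\<psi> y)}"
proof -
  let ?L = "lim_top A \<pi>"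
  have "openin (prod_topology ?L ?L) {z \<in> topspace (prod_topology ?L ?L).
      (\<phi> (fst z), \<psi> (snd z)) \<in> {(b, c). b \<in> verts B \<and> c \<in> verts C \<and> P b c}}"
  proof (rule openin_continuous_map_preimage)
    show "continuous_map (prod_topology ?L ?L)
        (prod_topology (discrete_topology (verts B)) (discrete_topology (verts C)))
        (\<lambda>z. (\<phi> (fst z), \<psi> (snd z)))"
      by (intro continuous_map_pairedI
          continuous_map_compose [OF continuous_map_fst continuous_map_lim_epi, unfolded o_def]
          continuous_map_compose [OF continuous_map_snd continuous_map_lim_epi, unfolded o_def] assms)
    show "openin (prod_topology (discrete_topology (verts B)) (discrete_topology (verts C)))
        {(b, c). b \<in> verts B \<and> c \<in> verts C \<and> P b c}"
      unfolding openin_prod_topology_alt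
    proof (intro allI impI)
      fix b c assume "(b, c) \<in> {(b, c). b \<in> verts B \<and> c \<in> verts C \<and> P b c}"
      then show "\<exists>U V. openin (discrete_topology (verts B)) U \<and> openin (discrete_topology (verts C)) V \<and>
          b \<in> U \<and> c \<in> V \<and> U \<times> V \<subseteq> {(b, c). b \<in> verts B \<and> c \<in> verts C \<and> P b c}"
        by (intro exI [of _ "{b}"] exI [of _ "{c}"]) simp
    qed
  qed
  also have "{z \<in> topspace (prod_topology ?L ?L).
      (\<phi> (fst z), \<psi> (snd z)) \<in> {(b, c). b \<in> verts B \<and> c \<in> verts C \<and> P b c}} =
      {(x, y). x \<in> plim \<and> y \<in> plim \<and> P (\<phi> x) (\<psi> y)}"
    using lim_epi_in [OF assms(1,2)] lim_epi_in [OF assms(3,4)] by auto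
  finally show ?thesis .
qed

lemma endo_continuous: "endo s \<Longrightarrow> continuous_map (lim_top A \<pi>) (lim_top A \<pi>) s"
proof -
  assume s: "endo s"
  have "continuous_map (lim_top A \<pi>) (discrete_topology (verts (A m))) (\<lambda>x. s x m)" for m
  proof -
    have "(\<lambda>x\<in>plim. s x m) \<in> lim_epi (A m)" using s by (simp add: endo_def)
    from continuous_map_lim_epi [OF this seq_objects] show ?thesis
      by (rule continuous_map_eq) simp
  qed
  then have "continuous_map (lim_top A \<pi>)
      (product_topology (\<lambda>i. discrete_topology (verts (A i))) UNIV) s"
    by (simp add: continuous_map_componentwise_UNIV)
  then have "continuous_map (lim_top A \<pi>)
      (subtopology (product_topology (\<lambda>i. discrete_topology (verts (A i))) UNIV) plim) s"
    using endo_in [OF s] by (auto simp: continuous_map_in_subtopology)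
  then show ?thesis by (simp add: lim_top_def)
qed

lemma compact_space_lim_top: "compact_space (lim_top A \<pi>)"
proof -
  let ?P = "product_topology (\<lambda>i. discrete_topology (verts (A i))) UNIV"
  have "compact_space (discrete_topology (verts (A i)))" for i
    using graphs [OF seq_objects]
    by (simp add: compact_space_discrete_topology finite_reflexive_graph_def)
  then have "compact_space ?P" by (simp add: compact_space_product_topology)
  moreover have "closedin ?P {x \<in> topspace ?P. \<pi> i (x (Suc i)) = x i}" for i
  proof -
    have 1: "continuous_map ?P (discrete_topology (verts (A i))) (\<lambda>x. x i)" for i
      by (rule continuous_map_product_projection) simp
    have "continuous_map (discrete_topology (verts (A (Suc i)))) (discrete_topology (verts (A i))) (\<pi> i)"
      using Epi_in [OF seq_maps seq_objects seq_objects] by auto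
    from continuous_map_compose [OF 1 this]
    have 2: "continuous_map ?P (discrete_topology (verts (A i))) (\<lambda>x. \<pi> i (x (Suc i)))"
      by (simp add: o_def)
    show ?thesis
      using closedin_continuous_maps_eq [OF Hausdorff_space_discrete_topology 2 1] .
  qed
  then have "closedin ?P (\<Inter>i. {x \<in> topspace ?P. \<pi> i (x (Suc i)) = x i})"
    by (intro closedin_Inter) auto
  moreover have "(\<Inter>i. {x \<in> topspace ?P. \<pi> i (x (Suc i)) = x i}) = plim"
    by (auto simp: lim_set_def PiE_iff)
  ultimately show ?thesis
    unfolding lim_top_def by (metis closedin_compact_space compact_space_subtopology)
qed

lemma autI:
  assumes s: "endo s" "s \<in> extensional plim" and t: "endo t"
    and st: "\<And>x. x \<in> plim \<Longrightarrow> s (t x) = x" "\<And>x. x \<in> plim \<Longrightarrow> t (s x) = x"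
  shows "s \<in> auts"
proof -
  have "homeomorphic_maps (lim_top A \<pi>) (lim_top A \<pi>) s t"
    using endo_continuous s(1) t st by (simp add: homeomorphic_maps_def)
  then have "s \<in> Homeo (lim_top A \<pi>)"
    using s(2) homeomorphic_map_maps unfolding Homeo_def topspace_lim_top by blast
  moreover have "inj_on s plim" by (metis inj_onI st(2))
  then have "inv_into plim s x = t x" if "x \<in> plim" for x
    using inv_into_f_f [OF _ endo_in [OF t that]] st(1) [OF that] by fastforce
  then have "compose plim \<phi> (inv_into plim s) = (\<lambda>x\<in>plim. \<phi> (t x))" for \<phi> :: "_ \<Rightarrow> 'v"
    by (auto simp: compose_def)
  ultimately show ?thesis
    using endo_lim_epi s(1) t by (simp add: aut_def compose_def)
qed

lemma aut_Homeo: "\<sigma> \<in> auts \<Longrightarrow> \<sigma> \<in> Homeo (lim_top A \<pi>)"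
  by (simp add: aut_def)

lemma aut_in: "\<lbrakk>\<sigma> \<in> auts; x \<in> plim\<rbrakk> \<Longrightarrow> \<sigma> x \<in> plim"
  using Homeo_in [OF aut_Homeo] by simp

lemma aut_bij_betw: "\<sigma> \<in> auts \<Longrightarrow> bij_betw \<sigma> plim plim"
  using Homeo_bij_betw [OF aut_Homeo] by simp

lemma aut_endo:
  assumes \<sigma>: "\<sigma> \<in> auts"
  shows "endo \<sigma>"
  unfolding endo_def
proof (intro conjI allI ballI)
  fix m
  have "compose plim (\<lambda>x\<in>plim. x m) \<sigma> \<in> lim_epi (A m)"
    using \<sigma> proj_lim_epi seq_objects by (auto simp: aut_def)
  also have "compose plim (\<lambda>x\<in>plim. x m) \<sigma> = (\<lambda>x\<in>plim. \<sigma> x m)"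
    using aut_in [OF \<sigma>] by (auto simp: compose_def)
  finally show "(\<lambda>x\<in>plim. \<sigma> x m) \<in> lim_epi (A m)" .
qed (rule aut_in [OF \<sigma>])

definition aut_inv :: "((nat \<Rightarrow> 'v) \<Rightarrow> nat \<Rightarrow> 'v) \<Rightarrow> (nat \<Rightarrow> 'v) \<Rightarrow> nat \<Rightarrow> 'v" where
  "aut_inv \<sigma> = restrict (inv_into plim \<sigma>) plim"

lemma aut_inv_cancel:
  assumes "\<sigma> \<in> auts" "x \<in> plim"
  shows "\<sigma> (aut_inv \<sigma> x) = x" "aut_inv \<sigma> (\<sigma> x) = x" "aut_inv \<sigma> x \<in> plim"
  using aut_bij_betw [OF assms(1)] aut_in [OF assms] assms(2)
  by (simp_all add: aut_inv_def bij_betw_def f_inv_into_f inv_into_into)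

lemma aut_inv_endo:
  assumes \<sigma>: "\<sigma> \<in> auts"
  shows "endo (aut_inv \<sigma>)"
  unfolding endo_def
proof (intro conjI allI ballI)
  fix m
  have "compose plim (\<lambda>x\<in>plim. x m) (inv_into plim \<sigma>) \<in> lim_epi (A m)"
    using \<sigma> proj_lim_epi seq_objects by (auto simp: aut_def)
  also have "compose plim (\<lambda>x\<in>plim. x m) (inv_into plim \<sigma>) = (\<lambda>x\<in>plim. aut_inv \<sigma> x m)"
    using aut_inv_cancel(3) [OF \<sigma>] by (auto simp: compose_def aut_inv_def)
  finally show "(\<lambda>x\<in>plim. aut_inv \<sigma> x m) \<in> lim_epi (A m)" .
qed (rule aut_inv_cancel(3) [OF \<sigma>])

lemma aut_inv_aut: "\<sigma> \<in> auts \<Longrightarrow> aut_inv \<sigma> \<in> auts"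
  by (rule autI [of _ \<sigma>]) (auto simp: aut_inv_endo aut_endo aut_inv_cancel, simp add: aut_inv_def)

text \<open>One step of the back-and-forth: \<open>lim_epi_lift\<close> lifts the projection to
  level \<open>p\<close> through \<open>h\<close>. The new level is raised above \<open>q\<close>,
  which makes the levels of the construction cofinal.\<close>

lemma lift_step:
  assumes h: "h \<in> Epi (A q) (A p)"
  obtains r h' where "q < r" "h' \<in> Epi (A r) (A q)" "\<And>x. x \<in> plim \<Longrightarrow> h (h' (x r)) = x p"
proof -
  obtain \<psi> where \<psi>: "\<psi> \<in> lim_epi (A q)" "\<And>x. x \<in> plim \<Longrightarrow> h (\<psi> x) = (\<lambda>x\<in>plim. x p) x"
    using lim_epi_lift [OF seq_objects seq_objects h proj_lim_epi] by blast
  obtain m where "\<And>n. m \<le> n \<Longrightarrow> \<exists>f\<in>Epi (A n) (A q). \<forall>x\<in>plim. \<psi> x = f (x n)"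
    using lim_epi_factor [OF \<psi>(1) seq_objects] by blast
  then obtain f where "f \<in> Epi (A (max m (Suc q))) (A q)" "\<forall>x\<in>plim. \<psi> x = f (x (max m (Suc q)))"
    by (meson max.cobounded1)
  then show thesis using that [of "max m (Suc q)" f] \<psi>(2) by fastforce
qed

text \<open>The maps with even index define an endomorphism; applied to the shifted sequence, the lemma gives
  an endomorphism from the maps with odd index, and the two are mutually inverse.\<close>

lemma thread_endo:
  fixes n :: "nat \<Rightarrow> nat" and h :: "nat \<Rightarrow> 'v \<Rightarrow> 'v"
  assumes n: "\<And>k. n k < n (Suc k)" and h: "\<And>k. h k \<in> Epi (A (n (Suc k))) (A (n k))"
    and hh: "\<And>k x. x \<in> plim \<Longrightarrow> h k (h (Suc k) (x (n (Suc (Suc k))))) = x (n k)"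
  obtains s where "endo s" "\<And>k x. x \<in> plim \<Longrightarrow> s x (n (2 * k)) = h (2 * k) (x (n (Suc (2 * k))))"
proof -
  have "strict_mono n" using n by (simp add: strict_mono_Suc_iff)
  then have nk: "k \<le> n k" for k by (rule strict_mono_imp_increasing)
  have n2: "k \<le> n (2 * k)" for k using nk [of "2 * k"] by simp
  have "\<exists>y. x \<in> plim \<longrightarrow> y \<in> plim \<and> y (n (2 * k)) = h (2 * k) (x (n (Suc (2 * k))))" for k x
    using lim_surj Epi_in [OF h seq_objects seq_objects lim_in] by metis
  then have "\<exists>w. \<forall>k x. x \<in> plim \<longrightarrow> w k x \<in> plim \<and> w k x (n (2 * k)) = h (2 * k) (x (n (Suc (2 * k))))"
    by (intro choice allI)
  then obtain w where w: "\<And>k x. x \<in> plim \<Longrightarrow> w k x \<in> plim"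
    "\<And>k x. x \<in> plim \<Longrightarrow> w k x (n (2 * k)) = h (2 * k) (x (n (Suc (2 * k))))"
    by blast
  \<comment> \<open>\<open>hh\<close> at \<open>2 * k\<close> introduces the odd map
    \<open>h (Suc (2 * k))\<close>, and \<open>hh\<close> at \<open>Suc (2 * k)\<close> removes it
    together with the next even map.\<close>
  have w_Suc: "w (Suc k) x (n (2 * k)) = w k x (n (2 * k))" if x: "x \<in> plim" for k x
  proof -
    let ?y = "w (Suc k) x"
    have "?y (n (2 * k)) = h (2 * k) (h (Suc (2 * k)) (?y (n (2 * Suc k))))"
      using hh [OF w(1) [OF x], of "2 * k" "Suc k"] by simp
    also have "\<dots> = h (2 * k) (h (Suc (2 * k)) (h (Suc (Suc (2 * k))) (x (n (Suc (Suc (Suc (2 * k))))))))"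
      using w(2) [OF x, of "Suc k"] by simp
    also have "\<dots> = h (2 * k) (x (n (Suc (2 * k))))"
      using hh [OF x, of "Suc (2 * k)"] by simp
    finally show ?thesis using w(2) [OF x] by simp
  qed
  have w_le: "w l x (n (2 * k)) = w k x (n (2 * k))" if x: "x \<in> plim" and "k \<le> l" for k l x
    using \<open>k \<le> l\<close>
  proof (induction l rule: dec_induct)
    case (step l)
    have "n (2 * k) \<le> n (2 * l)"
      using \<open>strict_mono n\<close> step(1) by (simp add: strict_mono_less_eq)
    then have "w (Suc l) x (n (2 * k)) = w l x (n (2 * k))"
      using lim_determines [OF w(1) [OF x] w(1) [OF x] w_Suc [OF x]] by blast
    then show ?case using step by simp
  qed simp
  \<comment> \<open>The diagonal is legitimate because \<open>j \<le> n (2 * j)\<close>: coordinate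
    \<open>j\<close> of \<open>w j x\<close> is already stable.\<close>
  define s where "s x j = w j x j" for x j
  have "s x \<in> plim" if x: "x \<in> plim" for x
  proof -
    have "w (Suc i) x i = w i x i" for i
      using lim_determines [OF w(1) [OF x] w(1) [OF x] w_Suc [OF x] n2] .
    moreover have "\<pi> i (w (Suc i) x (Suc i)) = w (Suc i) x i" for i
      using w(1) [OF x] by (simp add: lim_set_def)
    ultimately show ?thesis using lim_in [OF w(1) [OF x]] by (simp add: lim_set_def s_def)
  qed
  moreover have "(\<lambda>x\<in>plim. s x m) \<in> lim_epi (A m)" for m
  proof -
    let ?b = "bond A \<pi> m (n (2 * m) - m)"
    have b: "?b \<in> Epi (A (n (2 * m))) (A m)" using bond_Epi [of m "n (2 * m) - m"] n2 by simp
    have "(\<lambda>x\<in>plim. ?b ((\<lambda>x\<in>plim. h (2 * m) (x (n (Suc (2 * m))))) x)) \<in> lim_epi (A m)"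
      by (rule Epi_lim_epi [OF b lim_epiI [OF h] seq_objects seq_objects])
    also have "(\<lambda>x\<in>plim. ?b ((\<lambda>x\<in>plim. h (2 * m) (x (n (Suc (2 * m))))) x)) = (\<lambda>x\<in>plim. s x m)"
    proof (rule restrict_ext)
      fix x assume x: "x \<in> plim"
      show "?b ((\<lambda>x\<in>plim. h (2 * m) (x (n (Suc (2 * m))))) x) = s x m"
        using lim_bond [of "w m x" m "n (2 * m) - m"] w [OF x] n2 [of m] x by (simp add: s_def)
    qed
    finally show ?thesis .
  qed
  ultimately have "endo s" by (simp add: endo_def)
  moreover have "s x (n (2 * k)) = h (2 * k) (x (n (Suc (2 * k))))" if "x \<in> plim" for k x
    using w_le [OF that, of k "n (2 * k)"] w(2) [OF that] n2 by (simp add: s_def)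
  ultimately show thesis by (rule that)
qed

text \<open>Write \<open>\<phi>\<close> as \<open>f\<close> at level \<open>a\<close> and lift
  \<open>\<psi>\<close> through \<open>f\<close> to a map that factors as \<open>g\<close> at level
  \<open>b\<close>. Then \<open>\<phi> \<circ> \<sigma> = \<psi>\<close> holds as soon as
  \<open>\<sigma> x a = g (x b)\<close>, which is the first equation of a back-and-forth started at
  \<open>g\<close>.\<close>

lemma homogeneity:
  assumes B: "B \<in> \<K>" and \<phi>: "\<phi> \<in> lim_epi B" and \<psi>: "\<psi> \<in> lim_epi B"
  obtains \<sigma> where "\<sigma> \<in> auts" "\<And>x. x \<in> plim \<Longrightarrow> \<phi> (\<sigma> x) = \<psi> x"
proof -
  obtain f a where f: "f \<in> Epi (A a) B" "\<phi> = (\<lambda>x\<in>plim. f (x a))"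
    using \<phi> by (auto simp: lim_Epi_def)
  obtain \<psi>' where \<psi>': "\<psi>' \<in> lim_epi (A a)" "\<And>x. x \<in> plim \<Longrightarrow> f (\<psi>' x) = \<psi> x"
    using lim_epi_lift [OF B seq_objects f(1) \<psi>] by blast
  obtain m where "\<And>n. m \<le> n \<Longrightarrow> \<exists>g\<in>Epi (A n) (A a). \<forall>x\<in>plim. \<psi>' x = g (x n)"
    using lim_epi_factor [OF \<psi>'(1) seq_objects] by blast
  then obtain b g where g: "a < b" "g \<in> Epi (A b) (A a)" "\<And>x. x \<in> plim \<Longrightarrow> \<psi>' x = g (x b)"
    by (meson lessI max.cobounded1 max.cobounded2 less_le_trans)
  \<comment> \<open>A state is a map \<open>h\<close> from level \<open>q\<close> to level
    \<open>p\<close>; the map of its successor ends at \<open>q\<close>, and the two compose to the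
    projection to \<open>p\<close>. The clause for \<open>k = 0\<close> below pins the initial
    state.\<close>
  let ?ok = "\<lambda>(p :: nat, q :: nat, h :: 'v \<Rightarrow> 'v). p < q \<and> h \<in> Epi (A q) (A p)"
  let ?next = "\<lambda>(p :: nat, q :: nat, h :: 'v \<Rightarrow> 'v) (p' :: nat, r :: nat, h' :: 'v \<Rightarrow> 'v). p' = q \<and> (\<forall>x\<in>plim. h (h' (x r)) = x p)"
  have "\<exists>F. \<forall>k. (?ok (F k) \<and> (k = 0 \<longrightarrow> F k = (a, b, g))) \<and> ?next (F k) (F (Suc k))"
  proof (rule dependent_nat_choice [where P = "\<lambda>k S. ?ok S \<and> (k = 0 \<longrightarrow> S = (a, b, g))"
        and Q = "\<lambda>k. ?next"])
    show "\<exists>S. ?ok S \<and> ((0::nat) = 0 \<longrightarrow> S = (a, b, g))" using g by auto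
    fix S and k :: nat assume "?ok S \<and> (k = 0 \<longrightarrow> S = (a, b, g))"
    moreover obtain p q h where S: "S = (p, q, h)" by (cases S)
    ultimately have h: "h \<in> Epi (A q) (A p)" by simp
    obtain r h' where "q < r" "h' \<in> Epi (A r) (A q)" "\<And>x. x \<in> plim \<Longrightarrow> h (h' (x r)) = x p"
      using lift_step [OF h] by blast
    then show "\<exists>T. (?ok T \<and> (Suc k = 0 \<longrightarrow> T = (a, b, g))) \<and> ?next S T"
      by (intro exI [of _ "(q, r, h')"]) (simp add: S)
  qed
  then obtain F where *: "\<forall>k. (?ok (F k) \<and> (k = 0 \<longrightarrow> F k = (a, b, g))) \<and> ?next (F k) (F (Suc k))" ..
  have ok: "?ok (F k)" and nxt: "?next (F k) (F (Suc k))" for k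
    using spec [OF *, of k] by simp_all
  have F0: "F 0 = (a, b, g)" using spec [OF *, of 0] by simp
  define n where "n k = fst (F k)" for k
  define h where "h k = snd (snd (F k))" for k
  have F: "F k = (n k, n (Suc k), h k)" for k
    using nxt [of k] by (auto simp: n_def h_def split: prod.splits)
  have n: "n k < n (Suc k)" and h: "h k \<in> Epi (A (n (Suc k))) (A (n k))" for k
    using ok [of k] by (simp_all add: F)
  have hh: "h k (h (Suc k) (x (n (Suc (Suc k))))) = x (n k)" if "x \<in> plim" for k x
    using nxt [of k] that by (simp add: F)
  obtain s where s: "endo s" "\<And>k x. x \<in> plim \<Longrightarrow> s x (n (2 * k)) = h (2 * k) (x (n (Suc (2 * k))))"
    using thread_endo [of n h] n h hh by blast
  obtain t where t: "endo t"
    "\<And>k x. x \<in> plim \<Longrightarrow> t x (n (Suc (2 * k))) = h (Suc (2 * k)) (x (n (Suc (Suc (2 * k)))))"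
    using thread_endo [of "\<lambda>k. n (Suc k)" "\<lambda>k. h (Suc k)"] n h hh by blast
  have "strict_mono n" using n by (simp add: strict_mono_Suc_iff)
  then have nk: "k \<le> n k" for k by (rule strict_mono_imp_increasing)
  have st: "s (t x) = x" if x: "x \<in> plim" for x
  proof
    fix j
    have "s (t x) (n (2 * j)) = x (n (2 * j))"
      using s(2) [OF endo_in [OF t(1) x]] t(2) [OF x] hh [OF x] by simp
    moreover have "j \<le> n (2 * j)" using nk [of "2 * j"] by simp
    ultimately show "s (t x) j = x j"
      using lim_determines endo_in s(1) t(1) x by blast
  qed
  have ts: "t (s x) = x" if x: "x \<in> plim" for x
  proof
    fix j
    have "t (s x) (n (Suc (2 * j))) = h (Suc (2 * j)) (s x (n (2 * Suc j)))"
      using t(2) [OF endo_in [OF s(1) x]] by simp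
    also have "\<dots> = x (n (Suc (2 * j)))"
      using s(2) [OF x, of "Suc j"] hh [OF x, of "Suc (2 * j)"] by simp
    finally have "t (s x) (n (Suc (2 * j))) = x (n (Suc (2 * j)))" .
    moreover have "j \<le> n (Suc (2 * j))" using nk [of "Suc (2 * j)"] by simp
    ultimately show "t (s x) j = x j"
      using lim_determines endo_in s(1) t(1) x by blast
  qed
  show thesis
  proof (rule that)
    have "endo (restrict s plim)" using s(1) by (simp add: endo_def cong: restrict_cong)
    then show "restrict s plim \<in> auts"
      by (rule autI [OF _ _ t(1)]) (simp_all add: st ts endo_in t(1))
    fix x assume x: "x \<in> plim"
    have "s x a = g (x b)" using s(2) [OF x, of 0] F [of 0] F0 by simp
    then show "\<phi> (restrict s plim x) = \<psi> x"
      using x g(3) \<psi>'(2) endo_in [OF s(1) x] by (simp add: f(2))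
  qed
qed

section \<open>Realising objects by tuples of automorphisms\<close>

text \<open>The object consists of \<open>A k\<close>, \<open>A m\<close>, the factors
  \<open>d i\<close> of the \<open>m\<close>-th coordinates of \<open>\<delta> i\<close>, and the
  bonding map in the role of every \<open>e i\<close>. If \<open>x\<close> is any thread through
  \<open>a\<close>, then \<open>d i a = e i b\<close> says that \<open>b\<close> projects to the
  \<open>m\<close>-th coordinate of \<open>\<delta> i x\<close>, and this coordinate is all that
  \<open>\<phi>\<close> and \<open>\<phi>'\<close> see.\<close>

lemma common_psystem:
  assumes B: "B \<in> \<K>" "\<phi> \<in> lim_epi B" and B': "B' \<in> \<K>" "\<phi>' \<in> lim_epi B'"
    and \<delta>_auts: "\<delta> \<in> {..<n} \<rightarrow> auts"
  shows "\<exists>D C d e \<alpha> \<alpha>'. (D, C, d, e) \<in> psystems \<K> Epi n \<and> \<alpha> \<in> Epi D B \<and> \<alpha>' \<in> Epi D B' \<and>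
    (\<forall>i<n. \<forall>a\<in>verts D. \<forall>b\<in>verts D. d i a = e i b \<longrightarrow>
      (\<exists>x\<in>plim. \<alpha> a = \<phi> x \<and> \<alpha> b = \<phi> (\<delta> i x) \<and> \<alpha>' a = \<phi>' x \<and> \<alpha>' b = \<phi>' (\<delta> i x)))"
proof -
  have \<delta>: "\<delta> i \<in> auts" if "i < n" for i using \<delta>_auts that by auto
  obtain m1 where m1: "\<And>n. m1 \<le> n \<Longrightarrow> \<exists>f\<in>Epi (A n) B. \<forall>x\<in>plim. \<phi> x = f (x n)"
    using lim_epi_factor [OF B(2,1)] by blast
  obtain m2 where m2: "\<And>n. m2 \<le> n \<Longrightarrow> \<exists>f\<in>Epi (A n) B'. \<forall>x\<in>plim. \<phi>' x = f (x n)"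
    using lim_epi_factor [OF B'(2,1)] by blast
  define m where "m = max m1 m2"
  obtain f where f: "f \<in> Epi (A m) B" "\<And>x. x \<in> plim \<Longrightarrow> \<phi> x = f (x m)"
    using m1 [of m] by (auto simp: m_def)
  obtain f' where f': "f' \<in> Epi (A m) B'" "\<And>x. x \<in> plim \<Longrightarrow> \<phi>' x = f' (x m)"
    using m2 [of m] by (auto simp: m_def)
  have "\<exists>M. \<forall>k\<ge>M. \<exists>d\<in>Epi (A k) (A m). \<forall>x\<in>plim. \<delta> i x m = d (x k)" if i: "i < n" for i
  proof -
    have "(\<lambda>x\<in>plim. \<delta> i x m) \<in> lim_epi (A m)" using aut_endo [OF \<delta> [OF i]] by (simp add: endo_def)
    from lim_epi_factor [OF this seq_objects] obtain M where
      "\<And>k. M \<le> k \<Longrightarrow> \<exists>d\<in>Epi (A k) (A m). \<forall>x\<in>plim. (\<lambda>x\<in>plim. \<delta> i x m) x = d (x k)" by blast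
    then show ?thesis by (metis restrict_apply')
  qed
  then obtain M where M: "\<And>i k. \<lbrakk>i < n; M i \<le> k\<rbrakk> \<Longrightarrow> \<exists>d\<in>Epi (A k) (A m). \<forall>x\<in>plim. \<delta> i x m = d (x k)"
    by metis
  \<comment> \<open>Inserting \<open>m\<close> makes the set nonempty when \<open>n = 0\<close> and
    places \<open>k\<close> at or above \<open>m\<close>, as the bonding map requires.\<close>
  define k where "k = Max (insert m (M ` {..<n}))"
  have mk: "m \<le> k" and Mk: "\<And>i. i < n \<Longrightarrow> M i \<le> k" by (auto simp: k_def)
  obtain d where d: "\<And>i. i < n \<Longrightarrow> d i \<in> Epi (A k) (A m)"
    "\<And>i x. \<lbrakk>i < n; x \<in> plim\<rbrakk> \<Longrightarrow> \<delta> i x m = d i (x k)"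
    using M [OF _ Mk] by metis
  let ?b = "bond A \<pi> m (k - m)"
  have b: "?b \<in> Epi (A k) (A m)" using bond_Epi [of m "k - m"] mk by simp
  have bx: "?b (x k) = x m" if "x \<in> plim" for x using lim_bond [OF that, of m "k - m"] mk by simp
  show ?thesis
  proof (rule exI [of _ "A k"], rule exI [of _ "A m"], rule exI [of _ "restrict d {..<n}"],
      rule exI [of _ "\<lambda>i\<in>{..<n}. ?b"], rule exI [of _ "compose (verts (A k)) f ?b"],
      rule exI [of _ "compose (verts (A k)) f' ?b"], intro conjI allI ballI impI)
    show "(A k, A m, restrict d {..<n}, \<lambda>i\<in>{..<n}. ?b) \<in> psystems \<K> Epi n"
      using d(1) b seq_objects by (auto simp: psystems_def)
    show "compose (verts (A k)) f ?b \<in> Epi (A k) B"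
      by (rule Epi_comp [OF seq_objects seq_objects B(1) b f(1)])
    show "compose (verts (A k)) f' ?b \<in> Epi (A k) B'"
      by (rule Epi_comp [OF seq_objects seq_objects B'(1) b f'(1)])
    fix i a0 a1
    assume i: "i < n" and a: "a0 \<in> verts (A k)" "a1 \<in> verts (A k)"
      and "restrict d {..<n} i a0 = (\<lambda>i\<in>{..<n}. ?b) i a1"
    then have da: "d i a0 = ?b a1" by simp
    obtain x where x: "x \<in> plim" "x k = a0" using lim_surj [OF a(1)] by blast
    have "?b a0 = x m" "?b a1 = \<delta> i x m" using bx [OF x(1)] x da d(2) [OF i x(1)] by simp_all
    then show "\<exists>x\<in>plim. compose (verts (A k)) f ?b a0 = \<phi> x \<and>
        compose (verts (A k)) f ?b a1 = \<phi> (\<delta> i x) \<and>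
        compose (verts (A k)) f' ?b a0 = \<phi>' x \<and> compose (verts (A k)) f' ?b a1 = \<phi>' (\<delta> i x)"
      using a x(1) aut_in [OF \<delta> [OF i] x(1)]
      by (intro bexI [OF _ x(1)]) (simp add: compose_eq f(2) f'(2))
  qed
qed

lemma lim_epi_rel:
  "\<lbrakk>(x, y) \<in> rel; \<phi> \<in> lim_epi B; B \<in> \<K>\<rbrakk> \<Longrightarrow> (\<phi> x, \<phi> y) \<in> adj B"
  by (auto simp: lim_rel_def)

lemma closedin_rel: "closedin (prod_topology (lim_top A \<pi>) (lim_top A \<pi>)) rel"
proof -
  let ?LL = "prod_topology (lim_top A \<pi>) (lim_top A \<pi>)"
  let ?I = "{(B, \<phi>). B \<in> \<K> \<and> \<phi> \<in> lim_epi B}"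
  have "openin ?LL (\<Union>(B, \<phi>)\<in>?I. {(x, y). x \<in> plim \<and> y \<in> plim \<and> (\<phi> x, \<phi> y) \<notin> adj B})"
    by (intro openin_clauses(3) openin_Union) (auto intro!: openin_lim_epi)
  also have "(\<Union>(B, \<phi>)\<in>?I. {(x, y). x \<in> plim \<and> y \<in> plim \<and> (\<phi> x, \<phi> y) \<notin> adj B})
      = topspace ?LL - rel"
    by (auto simp: lim_rel_def)
  finally show ?thesis by (auto simp: closedin_def lim_rel_def)
qed

lemma nonempty_lim_epi:
  assumes "B \<in> \<K>"
  obtains \<phi> where "\<phi> \<in> lim_epi B"
proof -
  obtain m f where "f \<in> Epi (A m) B" using cofinal [OF assms] by blast
  then show thesis using that lim_epiI by blast
qed

lemma openin_aut_pointwise: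
  assumes "openin (prod_topology (lim_top A \<pi>) (lim_top A \<pi>)) W"
  shows "openin (aut_top \<K> Epi A \<pi>) {\<tau> \<in> auts. \<forall>x\<in>plim. (x, \<tau> x) \<in> W}"
proof -
  have "{\<tau> \<in> auts. \<forall>x\<in>plim. (x, \<tau> x) \<in> W} =
      {h \<in> Homeo (lim_top A \<pi>). \<forall>x\<in>topspace (lim_top A \<pi>). (x, h x) \<in> W} \<inter> auts"
    using aut_Homeo by auto
  then show ?thesis
    using openin_uniform_pointwise [OF assms] by (auto simp: aut_top_def openin_subtopology)
qed

lemma topspace_aut_top: "topspace (aut_top \<K> Epi A \<pi>) = auts"
  using aut_Homeo by (auto simp: aut_top_def)

definition exact_auts :: "'v psystem \<Rightarrow> ((nat \<Rightarrow> 'v) \<Rightarrow> 'v) \<Rightarrow> nat \<Rightarrow> ((nat \<Rightarrow> 'v) \<Rightarrow> nat \<Rightarrow> 'v) set" where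
  "exact_auts X \<phi> i = (case X of (B, C, f, g) \<Rightarrow>
     {\<tau> \<in> auts. \<forall>x\<in>plim. f i (\<phi> x) = g i (\<phi> (\<tau> x))})"

lemma exact_auts:
  assumes X: "(B, C, f, g) \<in> psystems \<K> Epi n" and i: "i < n" and \<phi>: "\<phi> \<in> lim_epi B"
  shows "openin (aut_top \<K> Epi A \<pi>) (exact_auts (B, C, f, g) \<phi> i)"
    and "exact_auts (B, C, f, g) \<phi> i \<noteq> {}"
proof -
  have BC: "B \<in> \<K>" "C \<in> \<K>" "f i \<in> Epi B C" "g i \<in> Epi B C"
    using X i by (auto simp: psystems_def)
  have "openin (aut_top \<K> Epi A \<pi>) {\<tau> \<in> auts. \<forall>x\<in>plim. (x, \<tau> x) \<in>
      {(x, y). x \<in> plim \<and> y \<in> plim \<and> f i (\<phi> x) = g i (\<phi> y)}}"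
    by (rule openin_aut_pointwise [OF openin_lim_epi [OF \<phi> BC(1) \<phi> BC(1)]])
  also have "\<dots> = exact_auts (B, C, f, g) \<phi> i"
    using aut_in by (auto simp: exact_auts_def)
  finally show "openin (aut_top \<K> Epi A \<pi>) (exact_auts (B, C, f, g) \<phi> i)" .
  obtain \<sigma> where "\<sigma> \<in> auts"
    "\<And>x. x \<in> plim \<Longrightarrow> (\<lambda>x\<in>plim. g i (\<phi> x)) (\<sigma> x) = (\<lambda>x\<in>plim. f i (\<phi> x)) x"
    using homogeneity [OF BC(2) Epi_lim_epi [OF BC(4) \<phi> BC(1,2)] Epi_lim_epi [OF BC(3) \<phi> BC(1,2)]]
    by blast
  then have "\<sigma> \<in> exact_auts (B, C, f, g) \<phi> i"
    by (auto simp: exact_auts_def aut_in)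
  then show "exact_auts (B, C, f, g) \<phi> i \<noteq> {}" by blast
qed

lemma exact_conj:
  assumes \<gamma>: "\<And>i. i < n \<Longrightarrow> \<gamma> i \<in> auts"
    and dense: "dense_in (power_topology (aut_top \<K> Epi A \<pi>) n) (conj_class (aut_group \<K> Epi A \<pi>) n \<gamma>)"
    and X: "(B, C, f, g) \<in> psystems \<K> Epi n"
  obtains \<phi> where "\<phi> \<in> lim_epi B"
    "\<And>i x. \<lbrakk>i < n; x \<in> plim\<rbrakk> \<Longrightarrow> f i (\<phi> x) = g i (\<phi> (\<gamma> i x))"
proof -
  have B: "B \<in> \<K>" using X by (auto simp: psystems_def)
  obtain \<phi>0 where \<phi>0: "\<phi>0 \<in> lim_epi B" using nonempty_lim_epi [OF B] .
  obtain \<tau> where \<tau>: "\<tau> \<in> conj_class (aut_group \<K> Epi A \<pi>) n \<gamma>"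
    "\<And>i. i < n \<Longrightarrow> \<tau> i \<in> exact_auts (B, C, f, g) \<phi>0 i"
    using dense_in_power_meets [OF dense, of "exact_auts (B, C, f, g) \<phi>0"] exact_auts [OF X _ \<phi>0]
    by blast
  have "auts \<subseteq> Bij plim" using Homeo_Bij aut_Homeo by fastforce
  then obtain h where h: "h \<in> auts" "\<And>i x. \<lbrakk>i < n; x \<in> plim\<rbrakk> \<Longrightarrow> \<tau> i (h x) = h (\<gamma> i x)"
    using conj_class_commute [of auts plim \<tau> n \<gamma>] aut_inv_aut \<tau>(1) \<gamma>
    unfolding aut_group_def aut_inv_def by blast
  show thesis
  proof (rule that)
    \<comment> \<open>At \<open>h x\<close> the condition on \<open>\<tau>\<close> reads
      \<open>f i (\<phi>0 (h x)) = g i (\<phi>0 (\<tau> i (h x)))\<close>, and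
      \<open>\<tau> i (h x) = h (\<gamma> i x)\<close>.\<close>
    show "(\<lambda>x\<in>plim. \<phi>0 (h x)) \<in> lim_epi B"
      by (rule endo_lim_epi [OF aut_endo [OF h(1)] B \<phi>0])
    fix i x assume "i < n" "x \<in> plim"
    then show "f i ((\<lambda>x\<in>plim. \<phi>0 (h x)) x) = g i ((\<lambda>x\<in>plim. \<phi>0 (h x)) (\<gamma> i x))"
      using \<tau>(2) [of i] h(2) [of i x] aut_in [OF h(1)] aut_in [OF \<gamma>]
      by (simp add: exact_auts_def)
  qed
qed

subsection \<open>Complete metrizability of the automorphism group\<close>

text \<open>By compactness: the pairs outside \<open>E\<close> that agree at \<open>m\<close> form
  decreasing closed sets, and a common point of all of them would be a diagonal pair outside
  \<open>E\<close>. So uniform closeness on the limit amounts to agreement at one sufficiently high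
  coordinate.\<close>

lemma entourage_coordinate:
  assumes E: "entourage (lim_top A \<pi>) E"
  obtains m where "\<And>x y. \<lbrakk>x \<in> plim; y \<in> plim; x m = y m\<rbrakk> \<Longrightarrow> (x, y) \<in> E"
proof (rule ccontr)
  let ?LL = "prod_topology (lim_top A \<pi>) (lim_top A \<pi>)"
  define C where "C m = {(x, y). x \<in> plim \<and> y \<in> plim \<and> x m = y m} - E" for m
  assume "\<not> thesis"
  then have "\<exists>x y. x \<in> plim \<and> y \<in> plim \<and> x m = y m \<and> (x, y) \<notin> E" for m using that by blast
  then have ne: "C m \<noteq> {}" for m by (auto simp: C_def)
  have clo: "closedin ?LL (C m)" for m
  proof -
    have "openin ?LL {(x, y). x \<in> plim \<and> y \<in> plim \<and> (\<lambda>x\<in>plim. x m) x \<noteq> (\<lambda>x\<in>plim. x m) y}"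
      by (rule openin_lim_epi [OF proj_lim_epi seq_objects proj_lim_epi seq_objects])
    moreover have "openin ?LL E" using E by (simp add: entourage_def)
    ultimately have "closedin ?LL (topspace ?LL -
        {(x, y). x \<in> plim \<and> y \<in> plim \<and> (\<lambda>x\<in>plim. x m) x \<noteq> (\<lambda>x\<in>plim. x m) y} - E)"
      by (intro closedin_diff closedin_topspace)
    also have "topspace ?LL -
        {(x, y). x \<in> plim \<and> y \<in> plim \<and> (\<lambda>x\<in>plim. x m) x \<noteq> (\<lambda>x\<in>plim. x m) y} - E = C m"
      by (auto simp: C_def)
    finally show ?thesis .
  qed
  have "decseq C"
    unfolding decseq_def C_def using lim_determines by blast
  moreover have "compact_space ?LL" by (simp add: compact_space_prod_topology compact_space_lim_top)
  ultimately obtain z where z: "\<And>m. z \<in> C m"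
    using compact_space_imp_nest [of ?LL C] clo ne by blast
  obtain x y where xy: "z = (x, y)" by (cases z)
  have "x = y" "x \<in> plim" "(x, y) \<notin> E" using z by (auto simp: xy C_def)
  then show False using E by (simp add: entourage_def)
qed

text \<open>Recording the inverse as well makes the image closed: without it, limits of automorphisms
  would only be surjective.\<close>

definition coords :: "((nat \<Rightarrow> 'v) \<Rightarrow> nat \<Rightarrow> 'v) \<Rightarrow> nat \<Rightarrow> ((nat \<Rightarrow> 'v) \<Rightarrow> 'v) \<times> ((nat \<Rightarrow> 'v) \<Rightarrow> 'v)" where
  "coords \<sigma> m = (\<lambda>x\<in>plim. \<sigma> x m, \<lambda>x\<in>plim. aut_inv \<sigma> x m)"

lemma coords_eq_iff:
  "coords \<tau> m = coords \<sigma> m \<longleftrightarrow> (\<forall>x\<in>plim. \<tau> x m = \<sigma> x m \<and> aut_inv \<tau> x m = aut_inv \<sigma> x m)"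
  by (auto simp: coords_def restrict_def fun_eq_iff)

text \<open>A countable power of discrete spaces is completely metrizable, whatever the size of the
  factors, so it remains to embed \<open>aut_top\<close> as a closed subspace.\<close>

abbreviation coord_top :: "(nat \<Rightarrow> ((nat \<Rightarrow> 'v) \<Rightarrow> 'v) \<times> ((nat \<Rightarrow> 'v) \<Rightarrow> 'v)) topology" where
  "coord_top \<equiv> product_topology (\<lambda>_. discrete_topology UNIV) UNIV"

text \<open>Agreement of the inverses becomes a pointwise condition on \<open>\<tau>\<close> itself
  when \<open>\<tau> x\<close> is substituted for the argument:
  \<open>x m = aut_inv \<sigma> (\<tau> x) m\<close> for all \<open>x\<close>. So
  \<open>openin_aut_pointwise\<close> applies.\<close>

lemma openin_coords:
  assumes \<sigma>: "\<sigma> \<in> auts"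
  shows "openin (aut_top \<K> Epi A \<pi>) {\<tau> \<in> auts. coords \<tau> m = coords \<sigma> m}"
proof -
  let ?pm = "\<lambda>x\<in>plim. x m"
  have i: "(\<lambda>x\<in>plim. aut_inv \<sigma> x m) \<in> lim_epi (A m)"
    and s: "(\<lambda>x\<in>plim. \<sigma> x m) \<in> lim_epi (A m)"
    using aut_inv_endo aut_endo \<sigma> by (auto simp: endo_def)
  let ?W = "{(x, y). x \<in> plim \<and> y \<in> plim \<and> (\<lambda>x\<in>plim. \<sigma> x m) x = ?pm y} \<inter>
    {(x, y). x \<in> plim \<and> y \<in> plim \<and> ?pm x = (\<lambda>x\<in>plim. aut_inv \<sigma> x m) y}"
  have "openin (prod_topology (lim_top A \<pi>) (lim_top A \<pi>)) ?W"
    by (intro openin_Int openin_lim_epi [OF s seq_objects proj_lim_epi seq_objects]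
        openin_lim_epi [OF proj_lim_epi seq_objects i seq_objects])
  then have "openin (aut_top \<K> Epi A \<pi>) {\<tau> \<in> auts. \<forall>x\<in>plim. (x, \<tau> x) \<in> ?W}"
    by (rule openin_aut_pointwise)
  also have "{\<tau> \<in> auts. \<forall>x\<in>plim. (x, \<tau> x) \<in> ?W} = {\<tau> \<in> auts. coords \<tau> m = coords \<sigma> m}"
  proof (rule Collect_cong, rule conj_cong [OF refl])
    fix \<tau> assume \<tau>: "\<tau> \<in> auts"
    have "(\<forall>x\<in>plim. x m = aut_inv \<sigma> (\<tau> x) m) \<longleftrightarrow> (\<forall>x\<in>plim. aut_inv \<tau> x m = aut_inv \<sigma> x m)"
    proof
      assume *: "\<forall>x\<in>plim. x m = aut_inv \<sigma> (\<tau> x) m"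
      show "\<forall>x\<in>plim. aut_inv \<tau> x m = aut_inv \<sigma> x m"
      proof
        fix x assume "x \<in> plim"
        then show "aut_inv \<tau> x m = aut_inv \<sigma> x m"
          using bspec [OF *, of "aut_inv \<tau> x"] aut_inv_cancel [OF \<tau>] by simp
      qed
    next
      assume *: "\<forall>x\<in>plim. aut_inv \<tau> x m = aut_inv \<sigma> x m"
      show "\<forall>x\<in>plim. x m = aut_inv \<sigma> (\<tau> x) m"
      proof
        fix x assume "x \<in> plim"
        then show "x m = aut_inv \<sigma> (\<tau> x) m"
          using bspec [OF *, of "\<tau> x"] aut_in [OF \<tau>] aut_inv_cancel [OF \<tau>] by simp
      qed
    qed
    then show "(\<forall>x\<in>plim. (x, \<tau> x) \<in> ?W) \<longleftrightarrow> coords \<tau> m = coords \<sigma> m"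
      using aut_in [OF \<tau>] by (auto simp: coords_eq_iff)
  qed
  finally show ?thesis .
qed

lemma continuous_map_coords: "continuous_map (aut_top \<K> Epi A \<pi>) coord_top coords"
  unfolding continuous_map_componentwise_UNIV
proof
  fix m
  have "openin (aut_top \<K> Epi A \<pi>) {\<sigma> \<in> auts. coords \<sigma> m \<in> U}" for U
  proof (subst openin_subopen, intro ballI)
    fix \<sigma> assume \<sigma>: "\<sigma> \<in> {\<sigma> \<in> auts. coords \<sigma> m \<in> U}"
    then have "openin (aut_top \<K> Epi A \<pi>) {\<tau> \<in> auts. coords \<tau> m = coords \<sigma> m}"
      using openin_coords by simp
    then show "\<exists>T. openin (aut_top \<K> Epi A \<pi>) T \<and> \<sigma> \<in> T \<and> T \<subseteq> {\<sigma> \<in> auts. coords \<sigma> m \<in> U}"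
      using \<sigma> by (intro exI [of _ "{\<tau> \<in> auts. coords \<tau> m = coords \<sigma> m}"]) auto
  qed
  then show "continuous_map (aut_top \<K> Epi A \<pi>) (discrete_topology UNIV) (\<lambda>\<sigma>. coords \<sigma> m)"
    by (simp add: continuous_map_def topspace_aut_top)
qed

lemma inj_on_coords: "inj_on coords auts"
proof (rule inj_onI)
  fix \<sigma> \<tau> assume \<sigma>: "\<sigma> \<in> auts" and \<tau>: "\<tau> \<in> auts" and eq: "coords \<sigma> = coords \<tau>"
  have "\<sigma> x = \<tau> x" if "x \<in> plim" for x
    using that eq coords_eq_iff by (intro ext) metis
  moreover have "\<sigma> \<in> extensional plim" "\<tau> \<in> extensional plim"
    using aut_Homeo \<sigma> \<tau> by (auto simp: Homeo_def)
  ultimately show "\<sigma> = \<tau>" by (metis extensionalityI)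
qed

lemma openin_coord_top: "openin coord_top {q. q m = c}"
proof -
  have "openin coord_top {q \<in> topspace coord_top. q m \<in> {c}}"
    by (rule openin_continuous_map_preimage [OF continuous_map_product_projection]) auto
  then show ?thesis by simp
qed

lemma open_map_coords: "open_map (aut_top \<K> Epi A \<pi>) (subtopology coord_top (coords ` auts)) coords"
  unfolding open_map_def
proof (intro allI impI)
  fix U assume U: "openin (aut_top \<K> Epi A \<pi>) U"
  show "openin (subtopology coord_top (coords ` auts)) (coords ` U)"
  proof (subst openin_subopen, intro ballI)
    fix q assume "q \<in> coords ` U"
    then obtain \<sigma> where \<sigma>: "\<sigma> \<in> U" "q = coords \<sigma>" by blast
    obtain V where V: "openin (uniform_topology (lim_top A \<pi>)) V" "U = V \<inter> auts"
      using U by (auto simp: aut_top_def openin_subtopology)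
    then obtain E where E: "entourage (lim_top A \<pi>) E"
      "{g \<in> Homeo (lim_top A \<pi>). \<forall>x\<in>plim. (\<sigma> x, g x) \<in> E} \<subseteq> V"
      using \<sigma>(1) unfolding openin_uniform_topology topspace_lim_top by blast
    obtain m where m: "\<And>x y. \<lbrakk>x \<in> plim; y \<in> plim; x m = y m\<rbrakk> \<Longrightarrow> (x, y) \<in> E"
      using entourage_coordinate [OF E(1)] by blast
    have \<sigma>a: "\<sigma> \<in> auts" using \<sigma> V by blast
    have "\<tau> \<in> U" if \<tau>: "\<tau> \<in> auts" "coords \<tau> m = coords \<sigma> m" for \<tau>
    proof -
      have "\<forall>x\<in>plim. (\<sigma> x, \<tau> x) \<in> E"
        using m aut_in [OF \<sigma>a] aut_in [OF \<tau>(1)] \<tau>(2) by (simp add: coords_eq_iff)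
      then show ?thesis using E(2) aut_Homeo [OF \<tau>(1)] \<tau>(1) V(2) by blast
    qed
    then have "{q. q m = coords \<sigma> m} \<inter> coords ` auts \<subseteq> coords ` U" by blast
    moreover have "openin (subtopology coord_top (coords ` auts)) ({q. q m = coords \<sigma> m} \<inter> coords ` auts)"
      using openin_coord_top openin_subtopology by blast
    ultimately show "\<exists>T. openin (subtopology coord_top (coords ` auts)) T \<and> q \<in> T \<and> T \<subseteq> coords ` U"
      using \<sigma>(2) \<sigma>a by (intro exI [of _ "{q. q m = coords \<sigma> m} \<inter> coords ` auts"]) auto
  qed
qed

text \<open>Since \<open>s\<close> is an endomorphism, coordinate \<open>m\<close> of its values
  depends on a single coordinate \<open>j\<close> of the argument, so approximants that agree with
  \<open>s\<close> and \<open>t\<close> up to \<open>max m j\<close> decide coordinate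
  \<open>m\<close> of \<open>s (t x)\<close>. Leaving \<open>\<sigma>\<close> and
  \<open>\<tau>\<close> arbitrary allows the roles of an automorphism and its inverse to be
  exchanged.\<close>

lemma limit_inverse:
  assumes s: "endo s" and t: "\<And>x. x \<in> plim \<Longrightarrow> t x \<in> plim" and x: "x \<in> plim"
    and lim: "\<And>N. \<exists>\<sigma> \<tau>. (\<forall>x\<in>plim. \<tau> x \<in> plim \<and> \<sigma> (\<tau> x) = x) \<and>
      (\<forall>m\<le>N. \<forall>x\<in>plim. \<sigma> x m = s x m \<and> \<tau> x m = t x m)"
  shows "s (t x) = x"
proof
  fix m
  have "(\<lambda>x\<in>plim. s x m) \<in> lim_epi (A m)" using s by (simp add: endo_def)
  then obtain f j where f: "(\<lambda>x\<in>plim. s x m) = (\<lambda>x\<in>plim. f (x j))"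
    by (auto simp: lim_Epi_def)
  have sf: "s y m = f (y j)" if "y \<in> plim" for y
    using fun_cong [OF f, of y] that by simp
  obtain \<sigma> \<tau> where \<sigma>\<tau>: "\<And>x. x \<in> plim \<Longrightarrow> \<tau> x \<in> plim" "\<And>x. x \<in> plim \<Longrightarrow> \<sigma> (\<tau> x) = x"
    "\<And>k x. \<lbrakk>k \<le> max m j; x \<in> plim\<rbrakk> \<Longrightarrow> \<sigma> x k = s x k"
    "\<And>k x. \<lbrakk>k \<le> max m j; x \<in> plim\<rbrakk> \<Longrightarrow> \<tau> x k = t x k"
    using lim [of "max m j"] by blast
  have "s (t x) m = f (\<tau> x j)" using sf [OF t [OF x]] \<sigma>\<tau>(4) [of j, OF _ x] by simp
  also have "\<dots> = \<sigma> (\<tau> x) m" using sf \<sigma>\<tau>(3) [of m] \<sigma>\<tau>(1) [OF x] by simp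
  finally show "s (t x) m = x m" using \<sigma>\<tau>(2) [OF x] by simp
qed

lemma closedin_coords: "closedin coord_top (coords ` auts)"
proof -
  have "p \<in> coords ` auts" if p: "p \<in> coord_top closure_of (coords ` auts)" for p
  proof -
    have ex: "\<exists>\<sigma>\<in>auts. \<forall>m\<le>N. coords \<sigma> m = p m" for N
    proof -
      let ?T = "(\<Inter>m\<in>{..N}. {q. q m = p m}) \<inter> topspace coord_top"
      have "openin coord_top ?T"
        by (intro openin_INT openin_coord_top finite_atMost)
      moreover have "p \<in> ?T" by simp
      ultimately have "\<exists>q. q \<in> coords ` auts \<and> q \<in> ?T"
        using p [unfolded in_closure_of, THEN conjunct2, THEN spec, of ?T] by (simp only: simp_thms)
      then show ?thesis by auto
    qed
    define s where "s = (\<lambda>x\<in>plim. \<lambda>m. fst (p m) x)"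
    define t where "t = (\<lambda>x\<in>plim. \<lambda>m. snd (p m) x)"
    have agree: "\<exists>\<sigma>\<in>auts. \<forall>m\<le>N. coords \<sigma> m = p m \<and>
        (\<forall>x\<in>plim. \<sigma> x m = s x m \<and> aut_inv \<sigma> x m = t x m)" for N
    proof -
      obtain \<sigma> where \<sigma>: "\<sigma> \<in> auts" "\<And>m. m \<le> N \<Longrightarrow> p m = coords \<sigma> m" using ex [of N] by metis
      then show ?thesis
        by (intro bexI [OF _ \<sigma>(1)]) (simp add: s_def t_def coords_def)
    qed
    \<comment> \<open>Membership in the limit relates only consecutive coordinates, so at
      \<open>i\<close> it suffices to agree with an actual thread at \<open>i\<close> and
      \<open>Suc i\<close>.\<close>
    have limI: "y \<in> plim" if y: "\<And>i. \<exists>z\<in>plim. z i = y i \<and> z (Suc i) = y (Suc i)" for y :: "nat \<Rightarrow> 'v"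
      unfolding lim_set_def
    proof (intro CollectI allI)
      fix i
      obtain z where "z \<in> plim" "z i = y i" "z (Suc i) = y (Suc i)" using y by blast
      then show "y i \<in> verts (A i) \<and> \<pi> i (y (Suc i)) = y i"
        by (metis (mono_tags, lifting) lim_set_def mem_Collect_eq)
    qed
    have s: "endo s"
      unfolding endo_def
    proof (intro conjI ballI allI)
      fix x assume x: "x \<in> plim"
      show "s x \<in> plim"
      proof (rule limI)
        fix i obtain \<sigma> where "\<sigma> \<in> auts" "\<And>m. m \<le> Suc i \<Longrightarrow> \<sigma> x m = s x m"
          using agree [of "Suc i"] x by blast
        then show "\<exists>z\<in>plim. z i = s x i \<and> z (Suc i) = s x (Suc i)"
          using x aut_in by (intro bexI [of _ "\<sigma> x"]) auto
      qed
    next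
      fix m
      obtain \<sigma> where \<sigma>: "\<sigma> \<in> auts" "\<And>x. x \<in> plim \<Longrightarrow> \<sigma> x m = s x m"
        using agree [of m] by blast
      then have "(\<lambda>x\<in>plim. s x m) = (\<lambda>x\<in>plim. \<sigma> x m)" by (intro restrict_ext) simp
      then show "(\<lambda>x\<in>plim. s x m) \<in> lim_epi (A m)" using aut_endo [OF \<sigma>(1)] by (simp add: endo_def)
    qed
    have t: "endo t"
      unfolding endo_def
    proof (intro conjI ballI allI)
      fix x assume x: "x \<in> plim"
      show "t x \<in> plim"
      proof (rule limI)
        fix i obtain \<sigma> where "\<sigma> \<in> auts" "\<And>m. m \<le> Suc i \<Longrightarrow> aut_inv \<sigma> x m = t x m"
          using agree [of "Suc i"] x by blast
        then show "\<exists>z\<in>plim. z i = t x i \<and> z (Suc i) = t x (Suc i)"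
          using x aut_inv_cancel(3) by (intro bexI [of _ "aut_inv \<sigma> x"]) auto
      qed
    next
      fix m
      obtain \<sigma> where \<sigma>: "\<sigma> \<in> auts" "\<And>x. x \<in> plim \<Longrightarrow> aut_inv \<sigma> x m = t x m"
        using agree [of m] by blast
      then have "(\<lambda>x\<in>plim. t x m) = (\<lambda>x\<in>plim. aut_inv \<sigma> x m)" by (intro restrict_ext) simp
      then show "(\<lambda>x\<in>plim. t x m) \<in> lim_epi (A m)" using aut_inv_endo [OF \<sigma>(1)] by (simp add: endo_def)
    qed
    have st: "s (t x) = x" if x: "x \<in> plim" for x
    proof (rule limit_inverse [OF s endo_in [OF t] x])
      fix N obtain \<sigma> where \<sigma>: "\<sigma> \<in> auts"
        "\<forall>m\<le>N. \<forall>x\<in>plim. \<sigma> x m = s x m \<and> aut_inv \<sigma> x m = t x m"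
        using agree [of N] by blast
      show "\<exists>\<sigma> \<tau>. (\<forall>x\<in>plim. \<tau> x \<in> plim \<and> \<sigma> (\<tau> x) = x) \<and>
          (\<forall>m\<le>N. \<forall>x\<in>plim. \<sigma> x m = s x m \<and> \<tau> x m = t x m)"
        by (rule exI [of _ \<sigma>], rule exI [of _ "aut_inv \<sigma>"]) (simp add: aut_inv_cancel [OF \<sigma>(1)] \<sigma>(2))
    qed
    have ts: "t (s x) = x" if x: "x \<in> plim" for x
    proof (rule limit_inverse [OF t endo_in [OF s] x])
      fix N obtain \<sigma> where \<sigma>: "\<sigma> \<in> auts"
        "\<forall>m\<le>N. \<forall>x\<in>plim. \<sigma> x m = s x m \<and> aut_inv \<sigma> x m = t x m"
        using agree [of N] by blast
      show "\<exists>\<sigma> \<tau>. (\<forall>x\<in>plim. \<tau> x \<in> plim \<and> \<sigma> (\<tau> x) = x) \<and>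
          (\<forall>m\<le>N. \<forall>x\<in>plim. \<sigma> x m = t x m \<and> \<tau> x m = s x m)"
        by (rule exI [of _ "aut_inv \<sigma>"], rule exI [of _ \<sigma>])
          (simp add: aut_inv_cancel [OF \<sigma>(1)] aut_in [OF \<sigma>(1)] \<sigma>(2))
    qed
    have sa: "s \<in> auts"
      by (rule autI [OF s _ t st ts]) (simp_all only: s_def restrict_extensional)
    have inv: "aut_inv s x = t x" if "x \<in> plim" for x
      using aut_inv_cancel(2) [OF sa endo_in [OF t that]] st [OF that] by simp
    have "coords s m = p m" for m
    proof -
      obtain \<sigma> where \<sigma>: "p m = coords \<sigma> m" "\<And>x. x \<in> plim \<Longrightarrow> \<sigma> x m = s x m \<and> aut_inv \<sigma> x m = t x m"
        using agree [of m] by (metis order_refl)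
      then show ?thesis by (simp add: coords_eq_iff inv)
    qed
    then have "p = coords s" by (simp add: fun_eq_iff)
    then show ?thesis using sa by blast
  qed
  then show ?thesis
    by (intro iffD1 [OF closure_of_subset_eq]) auto
qed

lemma completely_metrizable_aut_top: "completely_metrizable_space (aut_top \<K> Epi A \<pi>)"
proof -
  have "homeomorphic_map (aut_top \<K> Epi A \<pi>) (subtopology coord_top (coords ` auts)) coords"
    using continuous_map_coords open_map_coords inj_on_coords
    by (intro bijective_open_imp_homeomorphic_map)
      (auto simp: continuous_map_in_subtopology topspace_aut_top)
  then have "aut_top \<K> Epi A \<pi> homeomorphic_space subtopology coord_top (coords ` auts)"
    by (rule homeomorphic_map_imp_homeomorphic_space)
  moreover have "completely_metrizable_space coord_top"
    by (simp add: completely_metrizable_space_product_topology completely_metrizable_space_discrete_topology)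
  then have "completely_metrizable_space (subtopology coord_top (coords ` auts))"
    using completely_metrizable_space_closedin closedin_coords by blast
  ultimately show ?thesis using homeomorphic_completely_metrizable_space by blast
qed

lemma comeager_aut_imp_dense:
  assumes "comeager_in (power_topology (aut_top \<K> Epi A \<pi>) n) S"
  shows "dense_in (power_topology (aut_top \<K> Epi A \<pi>) n) S"
  by (rule comeager_imp_dense [OF completely_metrizable_power [OF completely_metrizable_aut_top] assms])

section \<open>The joint projection property\<close>

lemma psys_JPP_of_dense_conj_class:
  assumes \<gamma>: "\<gamma> \<in> {..<n} \<rightarrow>\<^sub>E auts"
    and dense: "dense_in (power_topology (aut_top \<K> Epi A \<pi>) n) (conj_class (aut_group \<K> Epi A \<pi>) n \<gamma>)"
  shows "psys_JPP \<K> Epi n"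
  unfolding psys_JPP_def
proof (intro ballI)
  fix X X' assume "X \<in> psystems \<K> Epi n" "X' \<in> psystems \<K> Epi n"
  moreover obtain B C f g B' C' f' g' where XX: "X = (B, C, f, g)" "X' = (B', C', f', g')"
    by (cases X; cases X') auto
  ultimately have X: "(B, C, f, g) \<in> psystems \<K> Epi n" and X': "(B', C', f', g') \<in> psystems \<K> Epi n"
    by simp_all
  have B: "B \<in> \<K>" "B' \<in> \<K>" using X X' by (auto simp: psystems_def)
  have \<gamma>a: "\<And>i. i < n \<Longrightarrow> \<gamma> i \<in> auts" using \<gamma> by auto
  have \<gamma>_auts: "\<gamma> \<in> {..<n} \<rightarrow> auts" using \<gamma> by auto
  obtain \<phi> where \<phi>: "\<phi> \<in> lim_epi B"
    "\<And>i x. \<lbrakk>i < n; x \<in> plim\<rbrakk> \<Longrightarrow> f i (\<phi> x) = g i (\<phi> (\<gamma> i x))"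
    using exact_conj [OF \<gamma>a dense X] by blast
  obtain \<phi>' where \<phi>': "\<phi>' \<in> lim_epi B'"
    "\<And>i x. \<lbrakk>i < n; x \<in> plim\<rbrakk> \<Longrightarrow> f' i (\<phi>' x) = g' i (\<phi>' (\<gamma> i x))"
    using exact_conj [OF \<gamma>a dense X'] by blast
  obtain D E d e \<alpha> \<alpha>' where Z: "(D, E, d, e) \<in> psystems \<K> Epi n" "\<alpha> \<in> Epi D B" "\<alpha>' \<in> Epi D B'"
    "\<forall>i<n. \<forall>a\<in>verts D. \<forall>b\<in>verts D. d i a = e i b \<longrightarrow>
      (\<exists>x\<in>plim. \<alpha> a = \<phi> x \<and> \<alpha> b = \<phi> (\<gamma> i x) \<and> \<alpha>' a = \<phi>' x \<and> \<alpha>' b = \<phi>' (\<gamma> i x))"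
    using common_psystem [OF B(1) \<phi>(1) B(2) \<phi>'(1) \<gamma>_auts] by blast
  have "f i (\<alpha> a) = g i (\<alpha> b)" "f' i (\<alpha>' a) = g' i (\<alpha>' b)"
    if "i < n" "a \<in> verts D" "b \<in> verts D" "d i a = e i b" for i a b
    using Z(4) that \<phi>(2) [OF that(1)] \<phi>'(2) [OF that(1)] by metis+
  then have "\<alpha> \<in> psys_epi Epi n (D, E, d, e) X" "\<alpha>' \<in> psys_epi Epi n (D, E, d, e) X'"
    using Z(2,3) by (simp_all add: XX)
  then show "\<exists>Z\<in>psystems \<K> Epi n. \<exists>\<alpha> \<alpha>'. \<alpha> \<in> psys_epi Epi n Z X \<and> \<alpha>' \<in> psys_epi Epi n Z X'"
    using Z(1) by blast
qed

end

subsection \<open>The quotient of the limit\<close>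

locale transitive_generic_sequence = generic_sequence +
  assumes trans_rel: "trans rel"
begin

abbreviation quot where "quot \<equiv> quot_top \<K> Epi A \<pi>"
abbreviation cls where "cls x \<equiv> rel `` {x}"
abbreviation pr where "pr \<equiv> pr_aut \<K> Epi A \<pi>"

lemma topspace_quot: "topspace quot = plim // rel"
  by (simp add: quot_top_def)

lemma equiv_rel: "equiv plim rel"
  by (rule equiv_lim_rel [OF trans_rel])

lemma cls_quot: "x \<in> plim \<Longrightarrow> cls x \<in> plim // rel"
  by (rule quotientI)

lemma quot_cases:
  assumes "u \<in> plim // rel" obtains x where "x \<in> plim" "u = cls x"
  using assms by (auto elim: quotientE)

lemma mem_quot:
  assumes u: "u \<in> plim // rel" and x: "x \<in> u"
  shows "x \<in> plim \<and> cls x = u"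
proof -
  obtain z where z: "u = cls z" using quot_cases [OF u] .
  then have zx: "(z, x) \<in> rel" using x by simp
  then have "x \<in> plim" by (simp add: lim_rel_def)
  then show ?thesis using equiv_class_eq [OF equiv_rel zx] z by simp
qed

lemma self_cls: "x \<in> plim \<Longrightarrow> x \<in> cls x"
  using equiv_rel by (rule equiv_class_self)

lemma cls_eq_iff: "\<lbrakk>x \<in> plim; y \<in> plim\<rbrakk> \<Longrightarrow> cls x = cls y \<longleftrightarrow> (x, y) \<in> rel"
  using eq_equiv_class_iff [OF equiv_rel] .

lemma continuous_map_cls: "continuous_map (lim_top A \<pi>) quot cls"
  unfolding continuous_map_def
  by (auto simp: topspace_quot cls_quot) (simp add: quot_top_def openin_quotient_topology)

lemma closedin_quot:
  "closedin quot D \<longleftrightarrow> D \<subseteq> plim // rel \<and> closedin (lim_top A \<pi>) {x \<in> plim. cls x \<in> D}"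
proof -
  have "{x \<in> plim. cls x \<in> plim // rel - D} = plim - {x \<in> plim. cls x \<in> D}"
    using cls_quot by auto
  then show ?thesis
    by (auto simp: closedin_def topspace_quot) (auto simp: quot_top_def openin_quotient_topology)
qed

text \<open>The saturation of a closed set is a projection of a closed subset of the compact square.
  Properness is wanted rather than mere closedness because it passes to the product map in
  \<open>openin_class_pairs\<close>, which closedness need not.\<close>

lemma proper_map_cls: "proper_map (lim_top A \<pi>) quot cls"
  unfolding proper_map_def closed_map_def
proof (intro conjI allI impI ballI)
  let ?L = "lim_top A \<pi>"
  fix D assume D: "closedin ?L D"
  then have Dsub: "D \<subseteq> plim" using closedin_subset by fastforce
  have "closedin (prod_topology ?L ?L) (rel \<inter> (D \<times> plim))"
    using closedin_rel D closedin_topspace [of ?L]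
    by (intro closedin_Int) (simp_all add: closedin_prod_Times_iff)
  then have "closedin ?L (snd ` (rel \<inter> (D \<times> plim)))"
    using Abstract_Topological_Spaces.closed_map_snd [OF compact_space_lim_top, of ?L]
    by (auto simp: closed_map_def)
  also have "snd ` (rel \<inter> (D \<times> plim)) = {x \<in> plim. \<exists>y\<in>D. (y, x) \<in> rel}"
    by (auto simp: image_iff Bex_def)
  also have "\<dots> = {x \<in> plim. \<exists>y\<in>D. cls x = cls y}"
    using Dsub cls_eq_iff by (metis (no_types, opaque_lifting) subsetD)
  also have "\<dots> = {x \<in> plim. cls x \<in> cls ` D}" by (simp add: image_iff)
  finally show "closedin quot (cls ` D)"
    using Dsub by (auto simp: closedin_quot cls_quot)
next
  let ?L = "lim_top A \<pi>"
  fix u assume "u \<in> topspace quot"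
  then obtain y where y: "y \<in> plim" "u = cls y" using quot_cases topspace_quot by metis
  have "continuous_map ?L (prod_topology ?L ?L) (\<lambda>x. (y, x))"
    using y by (intro continuous_map_pairedI) auto
  then have "closedin ?L {x \<in> topspace ?L. (y, x) \<in> rel}"
    using closedin_rel closedin_continuous_map_preimage by blast
  also have "{x \<in> topspace ?L. (y, x) \<in> rel} = {x \<in> topspace ?L. cls x = u}"
    using y cls_eq_iff by auto
  finally show "compactin ?L {x \<in> topspace ?L. cls x = u}"
    by (rule closedin_compact_space [OF compact_space_lim_top])
qed

text \<open>The universal, not the direct, image of \<open>M\<close> under the product of two
  quotient maps. It is the complement of the direct image of the complement of \<open>M\<close>,
  hence open for open \<open>M\<close> because that product map is closed.\<close>

definition class_pairs :: "((nat \<Rightarrow> 'a) \<times> (nat \<Rightarrow> 'a)) set \<Rightarrow> ((nat \<Rightarrow> 'a) set \<times> (nat \<Rightarrow> 'a) set) set" where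
  "class_pairs M = {(u, v). u \<in> plim // rel \<and> v \<in> plim // rel \<and> u \<times> v \<subseteq> M}"

lemma openin_class_pairs:
  assumes M: "openin (prod_topology (lim_top A \<pi>) (lim_top A \<pi>)) M"
  shows "openin (prod_topology quot quot) (class_pairs M)"
proof -
  let ?LL = "prod_topology (lim_top A \<pi>) (lim_top A \<pi>)"
  have "closed_map ?LL (prod_topology quot quot) (\<lambda>(x, y). (cls x, cls y))"
    using proper_map_cls proper_map_prod proper_imp_closed_map by blast
  moreover have "closedin ?LL (topspace ?LL - M)" using M by blast
  ultimately have "closedin (prod_topology quot quot)
      ((\<lambda>(x, y). (cls x, cls y)) ` (topspace ?LL - M))"
    unfolding closed_map_def by blast
  moreover have "class_pairs M =
      topspace (prod_topology quot quot) - (\<lambda>(x, y). (cls x, cls y)) ` (topspace ?LL - M)"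
  proof (intro equalityI subsetI)
    fix z assume z: "z \<in> class_pairs M"
    obtain u v where uv: "z = (u, v)" by (cases z)
    show "z \<in> topspace (prod_topology quot quot) - (\<lambda>(x, y). (cls x, cls y)) ` (topspace ?LL - M)"
      using z self_cls by (auto simp: uv class_pairs_def topspace_quot)
  next
    fix z assume z: "z \<in> topspace (prod_topology quot quot) -
      (\<lambda>(x, y). (cls x, cls y)) ` (topspace ?LL - M)"
    obtain u v where uv: "z = (u, v)" by (cases z)
    then have "u \<in> plim // rel" "v \<in> plim // rel" using z by (auto simp: topspace_quot)
    moreover have "u \<times> v \<subseteq> M"
    proof clarify
      fix x y assume "x \<in> u" "y \<in> v"
      then have "x \<in> plim" "cls x = u" "y \<in> plim" "cls y = v" using mem_quot calculation by auto
      then show "(x, y) \<in> M" using z uv by (force simp: image_iff)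
    qed
    ultimately show "z \<in> class_pairs M" by (simp add: class_pairs_def uv)
  qed
  ultimately show ?thesis by (simp only: openin_diff openin_topspace)
qed

lemma compact_space_quot: "compact_space quot"
proof -
  have "compactin quot (cls ` plim)"
    using image_compactin [OF _ continuous_map_cls] compact_space_lim_top
    by (metis compact_space_def topspace_lim_top)
  moreover have "cls ` plim = topspace quot"
    by (auto simp: topspace_quot quotient_def)
  ultimately show ?thesis by (simp add: compact_space_def)
qed

text \<open>Two classes differ exactly when no representatives of them are related, so the
  off-diagonal pairs are the universal image of the complement of the closed set
  \<open>rel\<close>.\<close>

lemma Hausdorff_space_quot: "Hausdorff_space quot"
proof -
  let ?LL = "prod_topology (lim_top A \<pi>) (lim_top A \<pi>)"
  have "(\<lambda>u. (u, u)) ` topspace quot = topspace (prod_topology quot quot) - class_pairs (topspace ?LL - rel)"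
  proof (intro equalityI subsetI)
    fix z assume "z \<in> (\<lambda>u. (u, u)) ` topspace quot"
    then obtain u where u: "u \<in> plim // rel" "z = (u, u)" by (auto simp: topspace_quot)
    obtain x where "x \<in> plim" "u = cls x" using quot_cases [OF u(1)] .
    then have x: "x \<in> plim" "z = (cls x, cls x)" using u(2) by simp_all
    then have "(x, x) \<in> cls x \<times> cls x" "(x, x) \<in> rel" using self_cls by auto
    then show "z \<in> topspace (prod_topology quot quot) - class_pairs (topspace ?LL - rel)"
      using x by (auto simp: topspace_quot cls_quot class_pairs_def)
  next
    fix z assume z: "z \<in> topspace (prod_topology quot quot) - class_pairs (topspace ?LL - rel)"
    then obtain u v where uv: "z = (u, v)" "u \<in> plim // rel" "v \<in> plim // rel"
      by (auto simp: topspace_quot)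
    then have "\<not> u \<times> v \<subseteq> topspace ?LL - rel" using z by (simp add: class_pairs_def)
    then obtain x y where xy: "x \<in> u" "y \<in> v" "(x, y) \<notin> topspace ?LL - rel"
      by (meson mem_Sigma_iff subrelI)
    have x: "x \<in> plim" "cls x = u" and y: "y \<in> plim" "cls y = v"
      using mem_quot [OF uv(2) xy(1)] mem_quot [OF uv(3) xy(2)] by auto
    then have "(x, y) \<in> rel" using xy(3) by simp
    then have "u = v" using cls_eq_iff [OF x(1) y(1)] x(2) y(2) by simp
    then show "z \<in> (\<lambda>u. (u, u)) ` topspace quot" using uv by (simp add: topspace_quot)
  qed
  moreover have "openin ?LL (topspace ?LL - rel)" using closedin_rel by blast
  then have "openin (prod_topology quot quot) (class_pairs (topspace ?LL - rel))"
    by (rule openin_class_pairs)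
  ultimately show ?thesis
    unfolding Hausdorff_space_closedin_diagonal by (simp only: closedin_diff closedin_topspace)
qed

section \<open>Approximate realisation on the quotient\<close>

definition near_pairs :: "'a psystem \<Rightarrow> ((nat \<Rightarrow> 'a) \<Rightarrow> 'a) \<Rightarrow> nat \<Rightarrow> ((nat \<Rightarrow> 'a) \<times> (nat \<Rightarrow> 'a)) set" where
  "near_pairs X \<phi> i = (case X of (B, C, f, g) \<Rightarrow>
     {(x, y). x \<in> plim \<and> y \<in> plim \<and> (f i (\<phi> x), g i (\<phi> y)) \<in> adj C})"

lemma openin_near_pairs:
  assumes "(B, C, f, g) \<in> psystems \<K> Epi n" "\<phi> \<in> lim_epi B"
  shows "openin (prod_topology quot quot) (class_pairs (near_pairs (B, C, f, g) \<phi> i))"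
proof (rule openin_class_pairs)
  have "B \<in> \<K>" using assms(1) by (simp add: psystems_def)
  from openin_lim_epi [OF assms(2) this assms(2) this, of "\<lambda>b c. (f i b, g i c) \<in> adj C"]
  show "openin (prod_topology (lim_top A \<pi>) (lim_top A \<pi>)) (near_pairs (B, C, f, g) \<phi> i)"
    by (simp add: near_pairs_def)
qed

text \<open>Given \<open>x\<close> in \<open>u\<close>, the class \<open>pr \<sigma> u\<close> may
  be computed as that of \<open>\<sigma> x\<close> for this same \<open>x\<close>. The exact
  equation at \<open>x\<close> then combines with the image under \<open>g i\<close> of the adjacent
  pair \<open>\<phi> (\<sigma> x)\<close>, \<open>\<phi> y\<close>.\<close>

lemma near_pairs_exact:
  assumes X: "(B, C, f, g) \<in> psystems \<K> Epi n" and \<phi>: "\<phi> \<in> lim_epi B" and i: "i < n"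
    and \<sigma>: "\<sigma> \<in> exact_auts (B, C, f, g) \<phi> i" and u: "u \<in> plim // rel"
  shows "(u, pr \<sigma> u) \<in> class_pairs (near_pairs (B, C, f, g) \<phi> i)"
proof -
  have BC: "B \<in> \<K>" "C \<in> \<K>" "f i \<in> Epi B C" "g i \<in> Epi B C"
    using X i by (auto simp: psystems_def)
  have \<sigma>a: "\<sigma> \<in> auts" and \<sigma>e: "\<And>x. x \<in> plim \<Longrightarrow> f i (\<phi> x) = g i (\<phi> (\<sigma> x))"
    using \<sigma> by (auto simp: exact_auts_def)
  have "(f i (\<phi> x), g i (\<phi> y)) \<in> adj C" if x: "x \<in> u" and y: "y \<in> pr \<sigma> u" for x y
  proof -
    have x': "x \<in> plim" "cls x = u" using mem_quot [OF u x] by auto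
    then have "pr \<sigma> u = cls (\<sigma> x)" using pr_aut_class [OF trans_rel \<sigma>a] by blast
    then have "(\<sigma> x, y) \<in> rel" using y by simp
    then have "(\<phi> (\<sigma> x), \<phi> y) \<in> adj B" using lim_epi_rel \<phi> BC(1) by blast
    then show ?thesis using Epi_adj [OF BC(4,1,2)] \<sigma>e [OF x'(1)] by simp
  qed
  moreover obtain x where x: "x \<in> plim" "u = cls x" using quot_cases [OF u] .
  then have "pr \<sigma> u \<in> plim // rel"
    using pr_aut_class [OF trans_rel \<sigma>a] cls_quot [OF aut_in [OF \<sigma>a]] by metis
  ultimately show ?thesis
    using u mem_quot [OF u] mem_quot [of "pr \<sigma> u"] by (simp add: class_pairs_def near_pairs_def subset_iff)
qed

text \<open>For a homeomorphism \<open>h\<close> of the quotient, \<open>\<phi>0 \<circ> h\<close>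
  makes no sense, so \<open>h\<close> has to be replaced by an automorphism before it is moved into
  \<open>\<phi>0\<close>. As \<open>\<gamma>\<close> also acts on classes only, the conclusion
  ranges over all \<open>y\<close> in the image of the class of \<open>x\<close>.\<close>

lemma approx_conj:
  assumes pr: "dense_in (uniform_topology quot) (pr ` auts)"
    and \<gamma>: "\<And>i. i < n \<Longrightarrow> \<gamma> i \<in> Homeo quot"
    and dense: "dense_in (power_topology (uniform_topology quot) n) (conj_class (homeo_group quot) n \<gamma>)"
    and X: "(B, C, f, g) \<in> psystems \<K> Epi n"
  obtains \<phi> where "\<phi> \<in> lim_epi B"
    "\<And>i x y. \<lbrakk>i < n; x \<in> plim; y \<in> plim; cls y = \<gamma> i (cls x)\<rbrakk> \<Longrightarrow> (f i (\<phi> x), g i (\<phi> y)) \<in> adj C"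
proof -
  have B: "B \<in> \<K>" using X by (auto simp: psystems_def)
  obtain \<phi>0 where \<phi>0: "\<phi>0 \<in> lim_epi B" using nonempty_lim_epi [OF B] .
  define W where "W i = class_pairs (near_pairs (B, C, f, g) \<phi>0 i)" for i
  have W: "openin (prod_topology quot quot) (W i)" for i
    using openin_near_pairs [OF X \<phi>0] by (simp add: W_def)
  have prH: "pr \<sigma> \<in> Homeo quot" if "\<sigma> \<in> auts" for \<sigma>
    using pr that by (auto simp: dense_in_def)
  let ?U = "\<lambda>i. {h \<in> Homeo quot. \<forall>u\<in>topspace quot. (u, h u) \<in> W i}"
  have "?U i \<noteq> {}" if i: "i < n" for i
  proof -
    obtain \<sigma> where \<sigma>: "\<sigma> \<in> exact_auts (B, C, f, g) \<phi>0 i"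
      using exact_auts(2) [OF X i \<phi>0] by blast
    then have "\<sigma> \<in> auts" by (simp add: exact_auts_def)
    then have "pr \<sigma> \<in> ?U i"
      using near_pairs_exact [OF X \<phi>0 i \<sigma>] prH by (simp add: topspace_quot W_def)
    then show ?thesis by blast
  qed
  then obtain \<tau> where \<tau>: "\<tau> \<in> conj_class (homeo_group quot) n \<gamma>" "\<And>i. i < n \<Longrightarrow> \<tau> i \<in> ?U i"
    using dense_in_power_meets [OF dense, of ?U] openin_uniform_pointwise [OF W] by blast
  obtain h where h: "h \<in> Homeo quot"
    "\<And>i u. \<lbrakk>i < n; u \<in> topspace quot\<rbrakk> \<Longrightarrow> \<tau> i (h u) = h (\<gamma> i u)"
    using conj_class_commute [OF Homeo_Bij Homeo_inv_into, of quot \<tau> n \<gamma>] \<tau>(1) \<gamma>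
    unfolding homeo_group_def by blast
  \<comment> \<open>Conjugation is written without the inverse of \<open>h\<close>, as a condition
    on \<open>(h u, h (\<gamma> i u))\<close>. It is open in \<open>h\<close>, so it can be met by
    some \<open>pr \<sigma>\<close>.\<close>
  let ?V = "{h \<in> Homeo quot. \<forall>i<n. \<forall>u\<in>topspace quot. (h u, h (\<gamma> i u)) \<in> W i}"
  have "openin (uniform_topology quot) ?V"
    using openin_uniform_conj [OF compact_space_quot Hausdorff_space_quot \<gamma> W]
    by (intro openin_uniform_all_less) blast
  moreover have "h \<in> ?V"
    using \<tau>(2) h Homeo_in [OF h(1)] by fastforce
  ultimately have "\<exists>y\<in>pr ` auts. y \<in> ?V" by (rule dense_in_meets [OF pr])
  then obtain \<sigma> where \<sigma>: "\<sigma> \<in> auts" "pr \<sigma> \<in> ?V" by (elim bexE imageE) simp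
  show thesis
  proof (rule that)
    show "(\<lambda>x\<in>plim. \<phi>0 (\<sigma> x)) \<in> lim_epi B"
      by (rule endo_lim_epi [OF aut_endo [OF \<sigma>(1)] B \<phi>0])
    fix i x y assume i: "i < n" and xy: "x \<in> plim" "y \<in> plim" "cls y = \<gamma> i (cls x)"
    have "(pr \<sigma> (cls x), pr \<sigma> (cls y)) \<in> W i"
      using \<sigma>(2) i xy by (simp add: topspace_quot cls_quot)
    then have "(cls (\<sigma> x), cls (\<sigma> y)) \<in> W i"
      by (simp only: pr_aut_class [OF trans_rel \<sigma>(1)] xy(1,2))
    then have "cls (\<sigma> x) \<times> cls (\<sigma> y) \<subseteq> near_pairs (B, C, f, g) \<phi>0 i"
      by (simp add: W_def class_pairs_def)
    then have "(\<sigma> x, \<sigma> y) \<in> near_pairs (B, C, f, g) \<phi>0 i"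
      using self_cls aut_in [OF \<sigma>(1)] xy by blast
    then show "(f i ((\<lambda>x\<in>plim. \<phi>0 (\<sigma> x)) x), g i ((\<lambda>x\<in>plim. \<phi>0 (\<sigma> x)) y)) \<in> adj C"
      using xy by (simp add: near_pairs_def)
  qed
qed

text \<open>\<open>common_psystem\<close> needs automorphisms, whereas \<open>\<gamma>\<close>
  consists of homeomorphisms of the quotient. The graph of each \<open>\<gamma> i\<close> lies in
  the open set \<open>?W\<close> that combines the conditions of both objects, so a single
  automorphism \<open>\<delta> i\<close> whose image has its graph in \<open>?W\<close> serves for
  both.\<close>

lemma psys_approx_JPP_of_dense_conj_class:
  assumes pr: "dense_in (uniform_topology quot) (pr ` auts)"
    and \<gamma>: "\<gamma> \<in> {..<n} \<rightarrow>\<^sub>E Homeo quot"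
    and dense: "dense_in (power_topology (uniform_topology quot) n) (conj_class (homeo_group quot) n \<gamma>)"
  shows "psys_approx_JPP \<K> Epi n"
  unfolding psys_approx_JPP_def
proof (intro ballI)
  fix X X' assume "X \<in> psystems \<K> Epi n" "X' \<in> psystems \<K> Epi n"
  moreover obtain B C f g B' C' f' g' where XX: "X = (B, C, f, g)" "X' = (B', C', f', g')"
    by (cases X; cases X') auto
  ultimately have X: "(B, C, f, g) \<in> psystems \<K> Epi n" and X': "(B', C', f', g') \<in> psystems \<K> Epi n"
    by simp_all
  have B: "B \<in> \<K>" "B' \<in> \<K>" using X X' by (auto simp: psystems_def)
  have \<gamma>H: "\<And>i. i < n \<Longrightarrow> \<gamma> i \<in> Homeo quot" using \<gamma> by auto
  obtain \<phi> where \<phi>: "\<phi> \<in> lim_epi B"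
    "\<And>i x y. \<lbrakk>i < n; x \<in> plim; y \<in> plim; cls y = \<gamma> i (cls x)\<rbrakk> \<Longrightarrow> (f i (\<phi> x), g i (\<phi> y)) \<in> adj C"
    using approx_conj [OF pr \<gamma>H dense X] by blast
  obtain \<phi>' where \<phi>': "\<phi>' \<in> lim_epi B'"
    "\<And>i x y. \<lbrakk>i < n; x \<in> plim; y \<in> plim; cls y = \<gamma> i (cls x)\<rbrakk> \<Longrightarrow> (f' i (\<phi>' x), g' i (\<phi>' y)) \<in> adj C'"
    using approx_conj [OF pr \<gamma>H dense X'] by blast
  have "\<exists>\<delta>\<in>auts. \<forall>x\<in>plim. (f i (\<phi> x), g i (\<phi> (\<delta> x))) \<in> adj C \<and>
      (f' i (\<phi>' x), g' i (\<phi>' (\<delta> x))) \<in> adj C'" if i: "i < n" for i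
  proof -
    let ?N = "near_pairs (B, C, f, g) \<phi> i" and ?N' = "near_pairs (B', C', f', g') \<phi>' i"
    let ?W = "class_pairs ?N \<inter> class_pairs ?N'"
    let ?U = "{h \<in> Homeo quot. \<forall>u\<in>topspace quot. (u, h u) \<in> ?W}"
    have U: "openin (uniform_topology quot) ?U"
      by (intro openin_uniform_pointwise openin_Int openin_near_pairs [OF X \<phi>(1)]
          openin_near_pairs [OF X' \<phi>'(1)])
    have "(u, \<gamma> i u) \<in> ?W" if u: "u \<in> plim // rel" for u
    proof -
      have v: "\<gamma> i u \<in> plim // rel" using Homeo_in [OF \<gamma>H [OF i]] u by (simp add: topspace_quot)
      have "(x, y) \<in> ?N \<and> (x, y) \<in> ?N'" if "x \<in> u" "y \<in> \<gamma> i u" for x y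
        using mem_quot [OF u that(1)] mem_quot [OF v that(2)] \<phi>(2) [OF i, of x y] \<phi>'(2) [OF i, of x y]
        by (simp add: near_pairs_def)
      then show ?thesis using u v by (auto simp: class_pairs_def)
    qed
    then have "\<gamma> i \<in> ?U" using \<gamma>H [OF i] topspace_quot by simp
    with U have "\<exists>h\<in>pr ` auts. h \<in> ?U" by (rule dense_in_meets [OF pr])
    then obtain \<delta> where \<delta>: "\<delta> \<in> auts" "pr \<delta> \<in> ?U" by (elim bexE imageE) simp
    have "(x, \<delta> x) \<in> ?N \<and> (x, \<delta> x) \<in> ?N'" if x: "x \<in> plim" for x
    proof -
      have "(cls x, cls (\<delta> x)) \<in> ?W"
        using \<delta>(2) pr_aut_class [OF trans_rel \<delta>(1) x] cls_quot [OF x] topspace_quot by auto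
      then show ?thesis
        using self_cls [OF x] self_cls [OF aut_in [OF \<delta>(1) x]] by (auto simp: class_pairs_def)
    qed
    then show ?thesis using \<delta>(1) by (auto simp: near_pairs_def)
  qed
  then obtain \<delta> where \<delta>: "\<And>i. i < n \<Longrightarrow> \<delta> i \<in> auts"
    "\<And>i x. \<lbrakk>i < n; x \<in> plim\<rbrakk> \<Longrightarrow> (f i (\<phi> x), g i (\<phi> (\<delta> i x))) \<in> adj C"
    "\<And>i x. \<lbrakk>i < n; x \<in> plim\<rbrakk> \<Longrightarrow> (f' i (\<phi>' x), g' i (\<phi>' (\<delta> i x))) \<in> adj C'"
    by metis
  have \<delta>_auts: "\<delta> \<in> {..<n} \<rightarrow> auts" using \<delta>(1) by auto
  obtain D E d e \<alpha> \<alpha>' where Z: "(D, E, d, e) \<in> psystems \<K> Epi n" "\<alpha> \<in> Epi D B" "\<alpha>' \<in> Epi D B'"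
    "\<forall>i<n. \<forall>a\<in>verts D. \<forall>b\<in>verts D. d i a = e i b \<longrightarrow>
      (\<exists>x\<in>plim. \<alpha> a = \<phi> x \<and> \<alpha> b = \<phi> (\<delta> i x) \<and> \<alpha>' a = \<phi>' x \<and> \<alpha>' b = \<phi>' (\<delta> i x))"
    using common_psystem [OF B(1) \<phi>(1) B(2) \<phi>'(1) \<delta>_auts] by blast
  have "(f i (\<alpha> a), g i (\<alpha> b)) \<in> adj C" "(f' i (\<alpha>' a), g' i (\<alpha>' b)) \<in> adj C'"
    if "i < n" "a \<in> verts D" "b \<in> verts D" "d i a = e i b" for i a b
    using Z(4) that \<delta>(2) [OF that(1)] \<delta>(3) [OF that(1)] by metis+
  then have "\<alpha> \<in> psys_approx_epi Epi n (D, E, d, e) X" "\<alpha>' \<in> psys_approx_epi Epi n (D, E, d, e) X'"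
    using Z(2,3) by (simp_all add: XX)
  then show "\<exists>Z\<in>psystems \<K> Epi n. \<exists>\<alpha> \<alpha>'. \<alpha> \<in> psys_approx_epi Epi n Z X \<and> \<alpha>' \<in> psys_approx_epi Epi n Z X'"
    using Z(1) by blast
qed

text \<open>The first object is realised without conjugation: a fixed \<open>\<phi>\<close> gives
  nonempty open conditions on the tuple, which the dense set of admissible \<open>\<gamma>\<close>
  meets. The second object gets only adjacency, since its conjugating element is a homeomorphism of
  the quotient. As \<open>\<gamma>\<close> consists of automorphisms, it enters
  \<open>common_psystem\<close> unchanged and the exact equation survives.\<close>

lemma psys_half_approx_JPP_of_comeager:
  assumes pr: "dense_in (uniform_topology quot) (pr ` auts)"
    and comeager: "comeager_in (power_topology (aut_top \<K> Epi A \<pi>) n)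
         {\<gamma> \<in> {..<n} \<rightarrow>\<^sub>E auts. dense_in (power_topology (uniform_topology quot) n)
              (conj_class (homeo_group quot) n (\<lambda>j\<in>{..<n}. pr (\<gamma> j)))}"
  shows "psys_half_approx_JPP \<K> Epi n"
  unfolding psys_half_approx_JPP_def
proof (intro ballI)
  fix X X' assume "X \<in> psystems \<K> Epi n" "X' \<in> psystems \<K> Epi n"
  moreover obtain B C f g B' C' f' g' where XX: "X = (B, C, f, g)" "X' = (B', C', f', g')"
    by (cases X; cases X') auto
  ultimately have X: "(B, C, f, g) \<in> psystems \<K> Epi n" and X': "(B', C', f', g') \<in> psystems \<K> Epi n"
    by simp_all
  have B: "B \<in> \<K>" "B' \<in> \<K>" using X X' by (auto simp: psystems_def)
  obtain \<phi> where \<phi>: "\<phi> \<in> lim_epi B" using nonempty_lim_epi [OF B(1)] .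
  let ?conj_dense = "\<lambda>\<gamma>. dense_in (power_topology (uniform_topology quot) n)
      (conj_class (homeo_group quot) n (\<lambda>j\<in>{..<n}. pr (\<gamma> j)))"
  define S where "S = {\<gamma> \<in> {..<n} \<rightarrow>\<^sub>E auts. ?conj_dense \<gamma>}"
  have S: "dense_in (power_topology (aut_top \<K> Epi A \<pi>) n) S"
    unfolding S_def by (rule comeager_aut_imp_dense [OF comeager])
  obtain \<gamma> where "\<gamma> \<in> S" and \<gamma>e: "\<And>i. i < n \<Longrightarrow> \<gamma> i \<in> exact_auts (B, C, f, g) \<phi> i"
    using dense_in_power_meets [OF S, of "exact_auts (B, C, f, g) \<phi>"] exact_auts [OF X _ \<phi>]
    by blast
  then have \<gamma>: "\<gamma> \<in> {..<n} \<rightarrow>\<^sub>E auts" "?conj_dense \<gamma>" by (simp_all add: S_def)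
  have \<gamma>a: "\<And>i. i < n \<Longrightarrow> \<gamma> i \<in> auts" using \<gamma>(1) by auto
  have \<gamma>_auts: "\<gamma> \<in> {..<n} \<rightarrow> auts" using \<gamma>(1) by auto
  have \<gamma>H: "(\<lambda>j\<in>{..<n}. pr (\<gamma> j)) i \<in> Homeo quot" if "i < n" for i
    using pr \<gamma>a [OF that] that by (auto simp: dense_in_def)
  obtain \<phi>' where \<phi>': "\<phi>' \<in> lim_epi B'"
    "\<And>i x y. \<lbrakk>i < n; x \<in> plim; y \<in> plim; cls y = (\<lambda>j\<in>{..<n}. pr (\<gamma> j)) i (cls x)\<rbrakk>
      \<Longrightarrow> (f' i (\<phi>' x), g' i (\<phi>' y)) \<in> adj C'"
    using approx_conj [OF pr \<gamma>H \<gamma>(2) X'] by blast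
  have near: "(f' i (\<phi>' x), g' i (\<phi>' (\<gamma> i x))) \<in> adj C'" if i: "i < n" and x: "x \<in> plim" for i x
    using \<phi>'(2) [OF i x aut_in [OF \<gamma>a [OF i] x]] pr_aut_class [OF trans_rel \<gamma>a [OF i] x] i by simp
  have exact: "f i (\<phi> x) = g i (\<phi> (\<gamma> i x))" if "i < n" "x \<in> plim" for i x
    using \<gamma>e [OF that(1)] that(2) by (auto simp: exact_auts_def)
  obtain D E d e \<alpha> \<alpha>' where Z: "(D, E, d, e) \<in> psystems \<K> Epi n" "\<alpha> \<in> Epi D B" "\<alpha>' \<in> Epi D B'"
    "\<forall>i<n. \<forall>a\<in>verts D. \<forall>b\<in>verts D. d i a = e i b \<longrightarrow>
      (\<exists>x\<in>plim. \<alpha> a = \<phi> x \<and> \<alpha> b = \<phi> (\<gamma> i x) \<and> \<alpha>' a = \<phi>' x \<and> \<alpha>' b = \<phi>' (\<gamma> i x))"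
    using common_psystem [OF B(1) \<phi> B(2) \<phi>'(1) \<gamma>_auts] by blast
  have "f i (\<alpha> a) = g i (\<alpha> b)" "(f' i (\<alpha>' a), g' i (\<alpha>' b)) \<in> adj C'"
    if "i < n" "a \<in> verts D" "b \<in> verts D" "d i a = e i b" for i a b
    using Z(4) that exact [OF that(1)] near [OF that(1)] by metis+
  then have "\<alpha> \<in> psys_epi Epi n (D, E, d, e) X" "\<alpha>' \<in> psys_approx_epi Epi n (D, E, d, e) X'"
    using Z(2,3) by (simp_all add: XX)
  then show "\<exists>Z\<in>psystems \<K> Epi n. \<exists>\<alpha> \<alpha>'. \<alpha> \<in> psys_epi Epi n Z X \<and> \<alpha>' \<in> psys_approx_epi Epi n Z X'"
    using Z(1) by blast
qed

end

theorem theorem3p10: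
  fixes \<K> :: "'v rgraph set"
    and Epi :: "'v rgraph \<Rightarrow> 'v rgraph \<Rightarrow> ('v \<Rightarrow> 'v) set"
    and A :: "nat \<Rightarrow> 'v rgraph" and \<pi> :: "nat \<Rightarrow> 'v \<Rightarrow> 'v" and n :: nat
  assumes "generic_sequence \<K> Epi A \<pi>"
    and "trans (lim_rel \<K> Epi A \<pi>)"
    and "dense_in (uniform_topology (quot_top \<K> Epi A \<pi>)) (pr_aut \<K> Epi A \<pi> ` aut \<K> Epi A \<pi>)"
  shows
    "((\<exists>\<gamma> \<in> {..<n} \<rightarrow>\<^sub>E Homeo (quot_top \<K> Epi A \<pi>).
         dense_in (power_topology (uniform_topology (quot_top \<K> Epi A \<pi>)) n)
           (conj_class (homeo_group (quot_top \<K> Epi A \<pi>)) n \<gamma>))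
       \<longrightarrow> psys_approx_JPP \<K> Epi n) \<and>
     (comeager_in (power_topology (aut_top \<K> Epi A \<pi>) n)
         {\<gamma> \<in> {..<n} \<rightarrow>\<^sub>E aut \<K> Epi A \<pi>.
            dense_in (power_topology (uniform_topology (quot_top \<K> Epi A \<pi>)) n)
              (conj_class (homeo_group (quot_top \<K> Epi A \<pi>)) n
                 (\<lambda>j\<in>{..<n}. pr_aut \<K> Epi A \<pi> (\<gamma> j)))}
       \<longrightarrow> psys_half_approx_JPP \<K> Epi n) \<and>
     ((\<exists>\<gamma> \<in> {..<n} \<rightarrow>\<^sub>E aut \<K> Epi A \<pi>.
         dense_in (power_topology (aut_top \<K> Epi A \<pi>) n)
           (conj_class (aut_group \<K> Epi A \<pi>) n \<gamma>))
       \<longrightarrow> psys_JPP \<K> Epi n)"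
proof -
  interpret transitive_generic_sequence \<K> Epi A \<pi>
    using assms(1,2) by (simp add: transitive_generic_sequence_def transitive_generic_sequence_axioms_def)
  show ?thesis
  proof (intro conjI impI)
    assume "\<exists>\<gamma>\<in>{..<n} \<rightarrow>\<^sub>E Homeo quot. dense_in (power_topology (uniform_topology quot) n)
      (conj_class (homeo_group quot) n \<gamma>)"
    then show "psys_approx_JPP \<K> Epi n"
      by (elim bexE) (rule psys_approx_JPP_of_dense_conj_class [OF assms(3)])
  next
    assume "\<exists>\<gamma>\<in>{..<n} \<rightarrow>\<^sub>E auts. dense_in (power_topology (aut_top \<K> Epi A \<pi>) n)
      (conj_class (aut_group \<K> Epi A \<pi>) n \<gamma>)"
    then show "psys_JPP \<K> Epi n"
      by (elim bexE) (rule psys_JPP_of_dense_conj_class)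
  qed (rule psys_half_approx_JPP_of_comeager [OF assms(3)])
qed

end
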